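(* Let $H\in\mathbb{R}^{d\times d}$ be symmetric positive semidefinite, let $\rho>0$, set $H_\rho = H+\rho I$, and let $\delta\in(0,1)$. Let $\Omega\in\mathbb{R}^{d\times s}$ have i.i.d. standard Gaussian entries, and let $P$ be the randomized Nyström preconditioner built from $\Omega$ (defined in the context). If the sketch size satisfies \[ s\geq 8\left(\sqrt{d_{\mathrm{eff}}(\rho)}+\sqrt{8\log(16/\delta)}\right)^{2}, \] then with probability at least $1-\delta$, \[ \kappa_{2}\big(P^{-1/2}H_{\rho}P^{-1/2}\big)\leq 8 . \]
   Context: For symmetric psd $H$ and $\rho>0$, the effective dimension is $d_{\mathrm{eff}}(\rho)=\mathrm{tr}\big(H(H+\rho I)^{-1}\big)$. Given a test matrix $\Omega\in\mathbb{R}^{d\times s}$, the Nyström approximation of $H$ is $H\langle\Omega\rangle=(H\Omega)(\Omega^{T}H\Omega)^{\dagger}(H\Omega)^{T}$, where $\dagger$ is the Moore–Penrose pseudoinverse. Write it in eigendecomposed form $H\langle\Omega\rangle=U\hat\Lambda U^{T}$, with $U\in\mathbb{R}^{d\times s}$ having orthonormal columns and $\hat\Lambda=\mathrm{diag}(\hat\lambda_1\ge\dots\ge\hat\lambda_s)\succeq 0$. The randomized Nyström preconditioner is \[ P=\frac{1}{\hat\lambda_s+\rho}\,U(\hat\Lambda+\rho I)U^{T}+(I-UU^{T}). \] $\kappa_2$ denotes the spectral condition number (ratio of largest to smallest eigenvalue for a symmetric positive definite matrix). *)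

theory Defs
  imports "HOL-Analysis.Analysis" "HOL-Probability.Probability"
begin

definition sym_mat :: "real^'n^'n \<Rightarrow> bool" where
  "sym_mat A \<longleftrightarrow> transpose A = A"

definition psd_mat :: "real^'n^'n \<Rightarrow> bool" where
  "psd_mat A \<longleftrightarrow> sym_mat A \<and> (\<forall>x. 0 \<le> x \<bullet> (A *v x))"

definition pd_mat :: "real^'n^'n \<Rightarrow> bool" where
  "pd_mat A \<longleftrightarrow> sym_mat A \<and> (\<forall>x. x \<noteq> 0 \<longrightarrow> 0 < x \<bullet> (A *v x))"

definition eff_dim :: "real^'n^'n \<Rightarrow> real \<Rightarrow> real" where
  "eff_dim H \<rho> = trace (H ** matrix_inv (H + \<rho> *\<^sub>R mat 1))"

definition pinv :: "real^'n^'m \<Rightarrow> real^'m^'n" where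
  "pinv A = (THE X. A ** X ** A = A \<and> X ** A ** X = X \<and>
                    transpose (A ** X) = A ** X \<and> transpose (X ** A) = X ** A)"

definition nystrom :: "real^'d^'d \<Rightarrow> real^'s^'d \<Rightarrow> real^'d^'d" where
  "nystrom H \<Omega> = (H ** \<Omega>) ** pinv (transpose \<Omega> ** H ** \<Omega>) ** transpose (H ** \<Omega>)"

definition nystrom_eig :: "real^'d^'d \<Rightarrow> real^'s^'d \<Rightarrow> real^'s^'d \<Rightarrow> real^'s^'s \<Rightarrow> bool" where
  "nystrom_eig H \<Omega> U \<Lambda> \<longleftrightarrow>
     transpose U ** U = mat 1 \<and>
     (\<forall>i j. i \<noteq> j \<longrightarrow> \<Lambda> $ i $ j = 0) \<and> (\<forall>i. 0 \<le> \<Lambda> $ i $ i) \<and>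
     nystrom H \<Omega> = U ** \<Lambda> ** transpose U"

definition diag_min :: "real^'s^'s \<Rightarrow> real" where
  "diag_min \<Lambda> = Min (range (\<lambda>i. \<Lambda> $ i $ i))"

definition nystrom_precond :: "real \<Rightarrow> real^'s^'d \<Rightarrow> real^'s^'s \<Rightarrow> real^'d^'d" where
  "nystrom_precond \<rho> U \<Lambda> =
     (1 / (diag_min \<Lambda> + \<rho>)) *\<^sub>R (U ** (\<Lambda> + \<rho> *\<^sub>R mat 1) ** transpose U)
     + (mat 1 - U ** transpose U)"

definition mat_sqrt :: "real^'n^'n \<Rightarrow> real^'n^'n" where
  "mat_sqrt A = (THE S. psd_mat S \<and> S ** S = A)"

definition mat_inv_sqrt :: "real^'n^'n \<Rightarrow> real^'n^'n" where
  "mat_inv_sqrt A = matrix_inv (mat_sqrt A)"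

definition eigenvalues :: "real^'n^'n \<Rightarrow> real set" where
  "eigenvalues A = {c. \<exists>v. v \<noteq> 0 \<and> A *v v = c *\<^sub>R v}"

text \<open>Spectral condition number of a symmetric positive definite matrix.\<close>
definition cond2 :: "real^'n^'n \<Rightarrow> real" where
  "cond2 A = Max (eigenvalues A) / Min (eigenvalues A)"

definition gaussian_matrix :: "(real^'s^'d) measure" where
  "gaussian_matrix = distr (PiM (UNIV :: ('d \<times> 's) set) (\<lambda>_. std_normal_distribution)) borel
                           (\<lambda>f. \<chi> i j. f (i, j))"

end

theory Submission
  imports Defs
begin

text \<open>
  Write \<open>s\<close> for the sketch size, \<open>K = H (H + \<rho> I)\<^sup>-\<^sup>1\<close> and \<open>d\<close> for the trace of \<open>K\<close>. If the error
  \<open>E\<close> of the Nystroem approximation satisfies \<open>E \<le> C \<rho>\<close>, then the eigenvalues of the preconditioned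
  matrix lie between \<open>\<rho>\<close> and \<open>(1 + C) \<rho>\<close> plus the smallest approximate eigenvalue, and the latter is
  at most \<open>\<rho> / 7\<close> because \<open>8 d \<le> s\<close>. Since the residual \<open>r\<close> of the \<open>H\<close>-orthogonal projection of \<open>x\<close>
  onto the range of \<open>\<Omega>\<close> has \<open>\<Omega>\<^sup>T H r = 0\<close> and \<open>x \<bullet> E x = r \<bullet> H r\<close>, the bound \<open>C = 48/7\<close> follows once no
  vector \<open>y = K\<^sup>1\<^sup>/\<^sup>2 x\<close> in the kernel of \<open>\<Omega>\<^sup>T\<close> has \<open>\<parallel>y\<parallel>\<^sup>2 > 48/55 * \<parallel>x\<parallel>\<^sup>2\<close>.

  This is uniform in \<open>x\<close> with dimension-free constants, and is obtained by Gaussian smoothing (the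
  PAC-Bayesian method). For fixed \<open>y\<close> the expectation of \<open>exp (- 2/3 * \<parallel>\<Omega>\<^sup>T y\<parallel>\<^sup>2)\<close> is
  \<open>(1 + 4/3 * \<parallel>y\<parallel>\<^sup>2)\<close> to the power \<open>- s / 2\<close>; after compensating this factor, the average over
  \<open>y = K\<^sup>1\<^sup>/\<^sup>2 \<theta>\<close> with \<open>\<theta> ~ N(0, 4/s * I)\<close> has expectation at most 1, so it is rarely large. On the
  other hand, translating the Gaussian to a kernel vector and applying Jensen's inequality bounds the
  average from below by an exponential in \<open>s\<close>, up to the energy \<open>\<Sum>\<^sub>i \<omega>\<^sub>i \<bullet> K \<omega>\<^sub>i\<close> of the columns \<open>\<omega>\<^sub>i\<close> of
  \<open>\<Omega>\<close>, which concentrates around \<open>s d\<close>.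
\<close>

declare transpose_matrix_vector [simp del]

section \<open>Adjoints and inner products, with transposes kept explicit\<close>

lemma inner_mult_transpose_eq:
  fixes A :: "real^'n^'m"
  shows "x \<bullet> (A *v y) = (transpose A *v x) \<bullet> y"
  by (metis dot_lmul_matrix transpose_matrix_vector)

lemma sym_mat_inner:
  fixes A :: "real^'n^'n"
  assumes "sym_mat A"
  shows "x \<bullet> (A *v y) = (A *v x) \<bullet> y"
  using assms by (metis inner_mult_transpose_eq sym_mat_def)

lemma matrix_mult_scaleR_left: "(c *\<^sub>R A) *v x = c *\<^sub>R (A *v x)" for A :: "real^'n^'m"
  by (simp add: scaleR_matrix_vector_assoc)

subsection \<open>Spectral theorem and its consequences\<close>

text \<open>First-order condition at a maximum: moving from \<open>v\<close> along the defect
  \<open>u = A *v v - c *\<^sub>R v\<close> gains \<open>2 * t * (u \<bullet> u)\<close> at first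
  order against a loss of order \<open>t\<^sup>2\<close>, so \<open>u\<close> must vanish.
  Invariance of \<open>V\<close> makes this direction admissible.\<close>

lemma rayleigh_maximizer_eigenvector:
  fixes A :: "real^'n^'n"
  assumes sym: "sym_mat A" and V: "subspace V" and inv: "\<And>x. x \<in> V \<Longrightarrow> A *v x \<in> V"
    and v: "v \<in> V" "norm v = 1"
    and max: "\<And>x. x \<in> V \<Longrightarrow> norm x = 1 \<Longrightarrow> x \<bullet> (A *v x) \<le> v \<bullet> (A *v v)"
  shows "A *v v = (v \<bullet> (A *v v)) *\<^sub>R v"
proof -
  define c where "c = v \<bullet> (A *v v)"
  have bound: "x \<bullet> (A *v x) \<le> c * (x \<bullet> x)" if "x \<in> V" for x
  proof (cases "x = 0")
    case False
    have "(x /\<^sub>R norm x) \<bullet> (A *v (x /\<^sub>R norm x)) \<le> c"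
      unfolding c_def using False V that by (intro max) (auto intro: subspace_scale)
    then have "(x \<bullet> (A *v x)) / (norm x)\<^sup>2 \<le> c"
      by (simp add: matrix_vector_mult_scaleR power2_eq_square divide_simps)
    then show ?thesis
      using False by (simp add: divide_simps power2_norm_eq_inner)
  qed simp
  define u where "u = A *v v - c *\<^sub>R v"
  have uV: "u \<in> V"
    unfolding u_def using V v inv by (intro subspace_diff subspace_scale) auto
  define K where "K = c * (u \<bullet> u) - u \<bullet> (A *v u)"
  have K: "K \<ge> 0"
    unfolding K_def using bound[OF uV] by simp
  have vv: "v \<bullet> v = 1"
    using v by (simp add: norm_eq_1)
  have quad: "2 * t * (u \<bullet> u) \<le> t\<^sup>2 * K" for t
  proof -
    have "v + t *\<^sub>R u \<in> V"
      using V v uV by (intro subspace_add subspace_scale) auto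
    from bound[OF this]
    have "(v + t *\<^sub>R u) \<bullet> (A *v (v + t *\<^sub>R u)) \<le> c * ((v + t *\<^sub>R u) \<bullet> (v + t *\<^sub>R u))" .
    moreover have "v \<bullet> (A *v u) = u \<bullet> (A *v v)"
      using sym_mat_inner[OF sym] by (metis inner_commute)
    moreover have "u \<bullet> (A *v v) = u \<bullet> u + c * (u \<bullet> v)"
      unfolding u_def by (simp add: algebra_simps)
    ultimately show ?thesis
      using vv unfolding K_def c_def[symmetric]
      by (simp add: inner_add_left inner_add_right matrix_vector_right_distrib
          matrix_vector_mult_scaleR inner_commute[of v u] algebra_simps power2_eq_square
          flip: c_def)
  qed
  have "u = 0"
  proof (rule ccontr)
    assume "u \<noteq> 0"
    then have uu: "u \<bullet> u > 0" by simp
    \<comment> \<open>Any small positive \<open>t\<close> would do; the summand 1 keeps the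
      denominator positive when \<open>K = 0\<close>.\<close>
    from quad[of "(u \<bullet> u) / (K + 1)"]
    have "2 * (u \<bullet> u) * (K + 1) \<le> (u \<bullet> u) * K"
      using K uu by (simp add: divide_simps power2_eq_square)
    moreover have "(u \<bullet> u) * K \<ge> 0" using uu K by simp
    ultimately show False
      using uu by (simp add: algebra_simps)
  qed
  then show ?thesis by (simp add: u_def c_def)
qed

lemma symmetric_eigenvector_exists:
  fixes A :: "real^'n^'n"
  assumes sym: "sym_mat A" and V: "subspace V" and inv: "\<And>x. x \<in> V \<Longrightarrow> A *v x \<in> V"
    and ne: "z \<in> V" "z \<noteq> 0"
  obtains v c where "v \<in> V" "norm v = 1" "A *v v = c *\<^sub>R v"
proof -
  let ?S = "V \<inter> sphere 0 1"
  have "compact ?S"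
    using closed_subspace[OF V] by (simp add: closed_Int_compact)
  moreover have "z /\<^sub>R norm z \<in> ?S"
    using ne V by (auto intro: subspace_scale)
  then have "?S \<noteq> {}" by blast
  moreover have "continuous_on ?S (\<lambda>x. x \<bullet> (A *v x))"
    by (intro continuous_intros matrix_vector_mult_linear_continuous_on)
  ultimately obtain v where v: "v \<in> ?S" and max: "\<forall>x\<in>?S. x \<bullet> (A *v x) \<le> v \<bullet> (A *v v)"
    using continuous_attains_sup[of ?S "\<lambda>x. x \<bullet> (A *v x)"] by blast
  have "A *v v = (v \<bullet> (A *v v)) *\<^sub>R v"
    using v max by (intro rayleigh_maximizer_eigenvector[OF sym V inv]) auto
  then show thesis using v that by auto
qed

text \<open>Induction on the dimension: after splitting off a unit eigenvector, symmetry keeps its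
  orthogonal complement inside \<open>V\<close> invariant.\<close>

lemma symmetric_eigenbasis_of_subspace:
  fixes A :: "real^'n^'n"
  assumes sym: "sym_mat A" and "subspace V" and "\<And>x. x \<in> V \<Longrightarrow> A *v x \<in> V"
  shows "\<exists>B. pairwise orthogonal B \<and> (\<forall>b\<in>B. norm b = 1 \<and> (\<exists>c. A *v b = c *\<^sub>R b)) \<and> span B = V"
  using assms(2,3)
proof (induction "dim V" arbitrary: V rule: less_induct)
  case less
  show ?case
  proof (cases "\<exists>z\<in>V. z \<noteq> 0")
    case False
    then have "V = {0}" using less.prems(1) subspace_0 by blast
    then show ?thesis by (intro exI[of _ "{}"]) auto
  next
    case True
    then obtain v c where v: "v \<in> V" "norm v = 1" "A *v v = c *\<^sub>R v"
      using symmetric_eigenvector_exists[OF sym less.prems] by metis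
    define W where "W = V \<inter> {x. orthogonal v x}"
    have W: "subspace W"
      unfolding W_def by (intro subspace_inter less.prems(1)) (rule subspace_orthogonal_to_vector)
    have Winv: "A *v x \<in> W" if "x \<in> W" for x
    proof -
      have "v \<bullet> (A *v x) = 0"
        using that v by (simp add: sym_mat_inner[OF sym] W_def orthogonal_def)
      then show ?thesis using that less.prems(2) by (simp add: W_def orthogonal_def)
    qed
    have "v \<notin> W" using v by (auto simp: W_def orthogonal_def)
    then have "W \<subset> V" using v by (auto simp: W_def)
    then have "dim W < dim V"
      using W less.prems(1) by (metis dim_psubset span_eq_iff)
    from less.hyps[OF this W Winv] obtain B
      where B: "pairwise orthogonal B" "\<forall>b\<in>B. norm b = 1 \<and> (\<exists>c. A *v b = c *\<^sub>R b)" "span B = W"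
      by blast
    have BW: "B \<subseteq> W" using B(3) span_superset by blast
    have "pairwise orthogonal (insert v B)"
      using B(1) BW by (auto simp: pairwise_insert W_def orthogonal_commute)
    moreover have "span (insert v B) = V"
    proof
      show "span (insert v B) \<subseteq> V"
        using BW v less.prems(1) by (intro span_minimal) (auto simp: W_def)
      show "V \<subseteq> span (insert v B)"
      proof
        fix x assume x: "x \<in> V"
        have "x - (v \<bullet> x) *\<^sub>R v \<in> W"
          using x v less.prems(1)
          by (auto simp: W_def orthogonal_def inner_diff_right subspace_diff subspace_scale norm_eq_1)
        then show "x \<in> span (insert v B)"
          using B(3) by (auto simp: span_insert)
      qed
    qed
    ultimately show ?thesis
      using B(2) v by (intro exI[of _ "insert v B"]) auto
  qed
qed

section \<open>Coordinates in an orthonormal basis\<close>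

definition orthonormal_family :: "('n \<Rightarrow> real^'n) \<Rightarrow> bool" where
  "orthonormal_family e \<longleftrightarrow> (\<forall>i j. e i \<bullet> e j = (if i = j then 1 else 0))"

theorem symmetric_eigenbasis:
  fixes A :: "real^'n^'n"
  assumes "sym_mat A"
  obtains e l where "orthonormal_family e" "\<And>j. A *v e j = l j *\<^sub>R e j"
proof -
  obtain B where B: "pairwise orthogonal B" "\<forall>b\<in>B. norm b = 1 \<and> (\<exists>c. A *v b = c *\<^sub>R b)"
      "span B = (UNIV :: (real^'n) set)"
    using symmetric_eigenbasis_of_subspace[OF assms subspace_UNIV] by auto
  have "independent B"
    using B by (intro pairwise_orthogonal_independent) auto
  then have "finite B" "card B = CARD('n)"
    using dim_eq_card[of B UNIV] B(3) by (auto simp: independent_imp_finite)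
  then obtain e :: "'n \<Rightarrow> real^'n" where e: "bij_betw e UNIV B"
    by (metis finite_same_card_bij finite)
  then have eB: "e j \<in> B" for j by (auto simp: bij_betw_def)
  have "orthonormal_family e"
    unfolding orthonormal_family_def
  proof (intro allI)
    fix i j
    show "e i \<bullet> e j = (if i = j then 1 else 0)"
    proof (cases "i = j")
      case False
      then have "e i \<noteq> e j" using e by (auto simp: bij_betw_def inj_def)
      then show ?thesis using False B(1) eB by (auto simp: pairwise_def orthogonal_def)
    qed (use B(2) eB in \<open>auto simp: norm_eq_1\<close>)
  qed
  moreover obtain l where "\<And>j. A *v e j = l j *\<^sub>R e j"
    using choice[of "\<lambda>j c. A *v e j = c *\<^sub>R e j"] B(2) eB by blast
  ultimately show thesis by (rule that)
qed

context
  fixes e :: "'n \<Rightarrow> real^'n"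
  assumes on: "orthonormal_family e"
begin

text \<open>A family indexed by the coordinate type is the row set of a square matrix, whose
  one-sided inverse is two-sided. This is where completeness of the family comes from.\<close>

lemma orthonormal_rows:
  defines "Q \<equiv> \<chi> i. e i"
  shows "Q ** transpose Q = mat 1" "transpose Q ** Q = mat 1"
proof -
  show *: "Q ** transpose Q = mat 1"
    using on unfolding Q_def orthonormal_family_def
    by (simp add: vec_eq_iff matrix_matrix_mult_def transpose_def mat_def inner_vec_def)
  then show "transpose Q ** Q = mat 1"
    by (simp add: matrix_left_right_inverse)
qed

lemma parseval: "x \<bullet> y = (\<Sum>j\<in>UNIV. (x \<bullet> e j) * (y \<bullet> e j))"
proof -
  let ?Q = "(\<chi> i. e i) :: real^'n^'n"
  have "x \<bullet> y = x \<bullet> ((transpose ?Q ** ?Q) *v y)"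
    using orthonormal_rows by simp
  also have "\<dots> = (?Q *v x) \<bullet> (?Q *v y)"
    by (simp add: inner_mult_transpose_eq flip: matrix_vector_mul_assoc)
  also have "\<dots> = (\<Sum>j\<in>UNIV. (x \<bullet> e j) * (y \<bullet> e j))"
    by (subst inner_vec_def) (simp add: matrix_vector_mul_component inner_commute)
  finally show ?thesis .
qed

lemma orthonormal_eqI: "(\<And>j. x \<bullet> e j = y \<bullet> e j) \<Longrightarrow> x = y"
proof -
  assume "\<And>j. x \<bullet> e j = y \<bullet> e j"
  then have "(x - y) \<bullet> (x - y) = 0"
    by (subst parseval) (simp add: inner_diff_left)
  then show "x = y" by simp
qed

lemma orthonormal_expansion: "x = (\<Sum>j\<in>UNIV. (x \<bullet> e j) *\<^sub>R e j)"
  using on by (intro orthonormal_eqI)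
    (simp add: inner_sum_left orthonormal_family_def if_distrib[of "(*) _"] cong: if_cong)

lemma inner_orthonormal_sum: "(\<Sum>j\<in>UNIV. c j *\<^sub>R e j) \<bullet> e i = c i"
  using on by (simp add: inner_sum_left orthonormal_family_def if_distrib[of "(*) _"] cong: if_cong)

lemma matrix_eqI_orthonormal:
  fixes A B :: "real^'n^'m"
  assumes "\<And>j. A *v e j = B *v e j"
  shows "A = B"
proof -
  have "A *v x = B *v x" for x
    by (subst (1 2) orthonormal_expansion[of x])
      (simp add: linear_sum[OF matrix_vector_mul_linear] matrix_vector_mult_scaleR assms)
  then show ?thesis by (simp add: matrix_eq)
qed

lemma trace_orthonormal: "trace A = (\<Sum>j\<in>UNIV. e j \<bullet> (A *v e j))"
proof -
  let ?Q = "(\<chi> i. e i) :: real^'n^'n"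
  have "trace A = trace (A ** (transpose ?Q ** ?Q))"
    using orthonormal_rows by simp
  also have "\<dots> = trace (?Q ** (A ** transpose ?Q))"
    by (metis matrix_mul_assoc trace_mul_sym)
  also have "\<dots> = (\<Sum>j\<in>UNIV. e j \<bullet> (A *v e j))"
    by (simp add: trace_def matrix_matrix_mult_def matrix_vector_mult_def inner_vec_def transpose_def)
  finally show ?thesis .
qed

text \<open>Functional calculus: with \<open>g\<close> a function of the eigenvalues this supplies
  square roots, pseudoinverses and resolvents in a common eigenbasis.\<close>

lemma spectral_matrix:
  "\<exists>A :: real^'n^'n. (\<forall>j. A *v e j = g j *\<^sub>R e j) \<and> sym_mat A \<and>
     (\<forall>x. x \<bullet> (A *v x) = (\<Sum>j\<in>UNIV. g j * (x \<bullet> e j)\<^sup>2))"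
proof -
  let ?f = "\<lambda>x. \<Sum>j\<in>UNIV. (g j * (x \<bullet> e j)) *\<^sub>R e j"
  have lin: "linear ?f"
    by (rule linearI) (simp_all add: inner_add_left algebra_simps sum.distrib scaleR_sum_right)
  let ?A = "matrix ?f"
  have A: "?A *v x = ?f x" for x
    using matrix_works[of ?f] lin by (simp add: linear_matrix_vector_mul_eq)
  have bil: "x \<bullet> (?A *v y) = (\<Sum>j\<in>UNIV. g j * (x \<bullet> e j) * (y \<bullet> e j))" for x y
    by (simp add: A inner_sum_right mult_ac)
  have "x \<bullet> (transpose ?A *v y) = x \<bullet> (?A *v y)" for x y
    by (subst inner_mult_transpose_eq) (simp add: bil inner_commute[of _ y] mult_ac)
  then have "transpose ?A *v y = ?A *v y" for y
    using vector_eq_ldot by blast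
  then have "sym_mat ?A"
    unfolding sym_mat_def by (subst matrix_eq) blast
  moreover have "?A *v e j = g j *\<^sub>R e j" for j
    using on by (intro orthonormal_eqI) (auto simp: A inner_orthonormal_sum orthonormal_family_def)
  ultimately show ?thesis
    using bil by (intro exI[of _ ?A]) (auto simp: power2_eq_square mult_ac)
qed

lemma eigenvalues_eq_range:
  assumes "\<And>j. A *v e j = l j *\<^sub>R e j" "sym_mat A"
  shows "eigenvalues A = range l"
proof (intro equalityI subsetI)
  fix c assume "c \<in> eigenvalues A"
  then obtain v where v: "v \<noteq> 0" "A *v v = c *\<^sub>R v" by (auto simp: eigenvalues_def)
  then obtain j where j: "v \<bullet> e j \<noteq> 0"
    using orthonormal_eqI[of v 0] by auto
  have "c * (v \<bullet> e j) = (A *v v) \<bullet> e j" using v by simp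
  also have "\<dots> = l j * (v \<bullet> e j)"
    using assms by (simp flip: sym_mat_inner)
  finally show "c \<in> range l" using j by auto
next
  fix c assume "c \<in> range l"
  then obtain j where "c = l j" by auto
  moreover have "e j \<noteq> 0" using on by (metis inner_zero_left orthonormal_family_def zero_neq_one)
  ultimately show "c \<in> eigenvalues A" using assms by (auto simp: eigenvalues_def)
qed

end

subsection \<open>Square roots and pseudoinverses\<close>

text \<open>The vector \<open>u = S *v v - sqrt c *\<^sub>R v\<close> is annihilated by
  \<open>S + sqrt c * I\<close>, which is positive definite for \<open>c > 0\<close>; for
  \<open>c = 0\<close> the squared norm of \<open>S *v v\<close> is zero. Hence a psd root is
  determined on every eigenvector, which gives its uniqueness.\<close>

lemma psd_sqrt_eigenvector:
  fixes S :: "real^'n^'n"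
  assumes S: "psd_mat S" and ev: "(S ** S) *v v = c *\<^sub>R v"
  shows "S *v v = sqrt c *\<^sub>R v"
proof (cases "v = 0")
  case False
  have sym: "sym_mat S" using S by (simp add: psd_mat_def)
  have "v \<bullet> ((S ** S) *v v) = (S *v v) \<bullet> (S *v v)"
    by (simp add: sym_mat_inner[OF sym] flip: matrix_vector_mul_assoc)
  then have eq: "(S *v v) \<bullet> (S *v v) = c * (v \<bullet> v)" using ev by simp
  then have c: "c \<ge> 0"
    using False by (metis inner_ge_zero inner_gt_zero_iff zero_le_mult_iff not_less)
  define u where "u = S *v v - sqrt c *\<^sub>R v"
  have "S *v u + sqrt c *\<^sub>R u = 0"
    using ev c by (simp add: u_def matrix_vector_mult_diff_distrib matrix_vector_mult_scaleR
        matrix_vector_mul_assoc algebra_simps)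
  then have "u \<bullet> (S *v u) + sqrt c * (u \<bullet> u) = 0"
    by (metis inner_add_right inner_scaleR_right inner_zero_right)
  moreover have "u \<bullet> (S *v u) \<ge> 0" using S by (simp add: psd_mat_def)
  moreover have "sqrt c * (u \<bullet> u) \<ge> 0" using c by simp
  ultimately have "sqrt c * (u \<bullet> u) = 0" by linarith
  then have "c = 0 \<or> u = 0" using c by auto
  then show ?thesis
    using eq by (auto simp: u_def)
qed simp

lemma mat_sqrt_properties:
  fixes A :: "real^'n^'n"
  assumes A: "psd_mat A"
  shows "psd_mat (mat_sqrt A)" "mat_sqrt A ** mat_sqrt A = A"
proof -
  obtain e l where e: "orthonormal_family e" and l: "\<And>j. A *v e j = l j *\<^sub>R e j"
    using symmetric_eigenbasis[of A] A by (auto simp: psd_mat_def)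
  have l0: "l j \<ge> 0" for j
  proof -
    have "0 \<le> e j \<bullet> (A *v e j)" using A by (simp add: psd_mat_def)
    then show ?thesis using e by (simp add: l orthonormal_family_def)
  qed
  obtain S :: "real^'n^'n" where S: "\<And>j. S *v e j = sqrt (l j) *\<^sub>R e j" "sym_mat S"
    "\<And>x. x \<bullet> (S *v x) = (\<Sum>j\<in>UNIV. sqrt (l j) * (x \<bullet> e j)\<^sup>2)"
    using spectral_matrix[OF e, of "\<lambda>j. sqrt (l j)"] by blast
  have "psd_mat S"
    using S l0 by (auto simp: psd_mat_def intro!: sum_nonneg mult_nonneg_nonneg)
  moreover have "S ** S = A"
    using l0 by (intro matrix_eqI_orthonormal[OF e])
      (simp add: S l matrix_vector_mult_scaleR flip: matrix_vector_mul_assoc)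
  moreover have "R = S" if "psd_mat R" "R ** R = A" for R
    using psd_sqrt_eigenvector[OF that(1)] that(2) l
    by (intro matrix_eqI_orthonormal[OF e]) (simp add: S)
  ultimately have "\<exists>!S. psd_mat S \<and> S ** S = A" by blast
  from theI'[OF this] show "psd_mat (mat_sqrt A)" "mat_sqrt A ** mat_sqrt A = A"
    by (auto simp: mat_sqrt_def)
qed

section \<open>The Moore-Penrose pseudoinverse of a symmetric matrix\<close>

definition moore_penrose :: "real^'n^'m \<Rightarrow> real^'m^'n \<Rightarrow> bool" where
  "moore_penrose A X \<longleftrightarrow> A ** X ** A = A \<and> X ** A ** X = X \<and>
     transpose (A ** X) = A ** X \<and> transpose (X ** A) = X ** A"

text \<open>\<open>A ** X\<close> and \<open>A ** Y\<close> are orthogonal projections with the same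
  range, hence equal, and likewise \<open>X ** A\<close> and \<open>Y ** A\<close>. Then
  \<open>X = X ** A ** X = Y ** A ** Y = Y\<close>.\<close>

lemma moore_penrose_unique:
  assumes X: "moore_penrose A X" and Y: "moore_penrose A Y"
  shows "X = Y"
proof -
  have "A ** X = A ** Y"
  proof -
    have "A ** X = (A ** Y) ** (A ** X)"
      using Y by (simp add: moore_penrose_def matrix_mul_assoc)
    also have "\<dots> = transpose (A ** Y) ** transpose (A ** X)"
      using X Y by (simp add: moore_penrose_def)
    also have "\<dots> = transpose ((A ** X) ** (A ** Y))"
      by (simp add: matrix_transpose_mul)
    also have "(A ** X) ** (A ** Y) = A ** Y"
      using X by (simp add: moore_penrose_def matrix_mul_assoc)
    finally show ?thesis using Y by (simp add: moore_penrose_def)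
  qed
  moreover have "X ** A = Y ** A"
  proof -
    have "X ** A = (X ** A) ** (Y ** A)"
      using Y by (simp add: moore_penrose_def flip: matrix_mul_assoc)
    also have "\<dots> = transpose (X ** A) ** transpose (Y ** A)"
      using X Y by (simp add: moore_penrose_def)
    also have "\<dots> = transpose ((Y ** A) ** (X ** A))"
      by (simp add: matrix_transpose_mul)
    also have "(Y ** A) ** (X ** A) = Y ** A"
      using X by (simp add: moore_penrose_def flip: matrix_mul_assoc)
    finally show ?thesis using Y by (simp add: moore_penrose_def)
  qed
  ultimately show ?thesis
    using X Y unfolding moore_penrose_def by (metis matrix_mul_assoc)
qed

lemma pinv_symmetric:
  fixes A :: "real^'n^'n"
  assumes A: "sym_mat A"
  shows "moore_penrose A (pinv A)" "sym_mat (pinv A)" "A ** pinv A = pinv A ** A"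
proof -
  obtain e l where e: "orthonormal_family e" and l: "\<And>j. A *v e j = l j *\<^sub>R e j"
    using symmetric_eigenbasis[OF A] by auto
  \<comment> \<open>The convention \<open>inverse 0 = 0\<close> is exactly what the pseudoinverse
    does on the kernel.\<close>
  obtain X :: "real^'n^'n" where X: "\<And>j. X *v e j = inverse (l j) *\<^sub>R e j" "sym_mat X"
    using spectral_matrix[OF e, of "\<lambda>j. inverse (l j)"] by blast
  have comm: "A ** X = X ** A"
    by (intro matrix_eqI_orthonormal[OF e])
      (simp add: X l matrix_vector_mult_scaleR mult_ac flip: matrix_vector_mul_assoc)
  have "A ** X ** A = A" "X ** A ** X = X"
    by (intro matrix_eqI_orthonormal[OF e];
        simp add: X l matrix_vector_mult_scaleR field_simps flip: matrix_vector_mul_assoc)+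
  moreover have "transpose (A ** X) = A ** X"
    using A X comm by (simp add: matrix_transpose_mul sym_mat_def)
  ultimately have mp: "moore_penrose A X"
    using comm by (simp add: moore_penrose_def)
  have "pinv A = X"
    unfolding pinv_def moore_penrose_def[symmetric]
    using mp moore_penrose_unique by blast
  then show "moore_penrose A (pinv A)" "sym_mat (pinv A)" "A ** pinv A = pinv A ** A"
    using mp X comm by auto
qed

subsection \<open>Deterministic bounds for the preconditioner\<close>

lemma transpose_add: "transpose (A + B) = transpose A + transpose B" for A B :: "real^'n^'m"
  by (simp add: transpose_def vec_eq_iff)

lemma transpose_diff: "transpose (A - B) = transpose A - transpose B" for A B :: "real^'n^'m"
  by (simp add: transpose_def vec_eq_iff)

lemma matrix_inv_eqI:
  fixes A B :: "real^'n^'n"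
  assumes "A ** B = mat 1"
  shows "matrix_inv A = B"
  unfolding matrix_inv_def
proof (rule some_equality)
  show "A ** B = mat 1 \<and> B ** A = mat 1"
    using assms matrix_left_right_inverse by blast
  show "C = B" if "A ** C = mat 1 \<and> C ** A = mat 1" for C
    using assms that by (metis matrix_mul_assoc matrix_mul_lid matrix_mul_rid)
qed

text \<open>The quadratic form is the squared norm of the square root of \<open>H\<close> applied to
  \<open>z\<close>.\<close>

lemma psd_mat_kernel:
  fixes H :: "real^'n^'n"
  assumes H: "psd_mat H" and z: "z \<bullet> (H *v z) = 0"
  shows "H *v z = 0"
proof -
  let ?S = "mat_sqrt H"
  have S: "sym_mat ?S" "?S ** ?S = H"
    using mat_sqrt_properties[OF H] by (auto simp: psd_mat_def)
  have "(?S *v z) \<bullet> (?S *v z) = z \<bullet> ((?S ** ?S) *v z)"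
    by (simp add: sym_mat_inner[OF S(1)] flip: matrix_vector_mul_assoc)
  then have "?S *v z = 0" using z S(2) by simp
  then have "(?S ** ?S) *v z = 0" by (simp flip: matrix_vector_mul_assoc)
  then show ?thesis using S(2) by simp
qed

text \<open>The residual $r = x - \Omega (\Omega^T H \Omega)^\dagger \Omega^T H x$ of the
  $H$-orthogonal projection onto the range of $\Omega$.\<close>

lemma nystrom_residual:
  fixes H :: "real^'d^'d" and \<Omega> :: "real^'s^'d"
  assumes H: "psd_mat H"
  obtains r where "transpose \<Omega> *v (H *v r) = 0"
    "x \<bullet> (H *v x) - x \<bullet> (nystrom H \<Omega> *v x) = r \<bullet> (H *v r)"
    "r \<bullet> (H *v r) = x \<bullet> (H *v r)"
proof -
  have symH: "sym_mat H" and tH: "transpose H = H"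
    using H by (auto simp: psd_mat_def sym_mat_def)
  define S where "S = transpose \<Omega> ** H ** \<Omega>"
  have symS: "sym_mat S"
    by (simp add: S_def sym_mat_def matrix_transpose_mul tH matrix_mul_assoc)
  note pi = pinv_symmetric[OF symS]
  have SX: "S ** pinv S ** S = S" "transpose (S ** pinv S) = S ** pinv S"
    using pi by (auto simp: moore_penrose_def)
  define b where "b = transpose \<Omega> *v (H *v x)"
  \<comment> \<open>The aim is \<open>p = 0\<close>, so that the projection
    \<open>S ** pinv S\<close> fixes \<open>b\<close>. Since \<open>S *v p = 0\<close>, the vector
    \<open>\<Omega> *v p\<close> lies in the kernel of \<open>H\<close>; this makes \<open>p\<close>
    orthogonal to \<open>b\<close>, and it is orthogonal to the range of \<open>S\<close>
    anyway.\<close>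
  define p where "p = b - (S ** pinv S) *v b"
  have "S ** (S ** pinv S) = S"
    using SX(1) pi(3) by (metis matrix_mul_assoc)
  then have Sp: "S *v p = 0"
    by (simp add: p_def matrix_vector_mult_diff_distrib matrix_vector_mul_assoc)
  have "(\<Omega> *v p) \<bullet> (H *v (\<Omega> *v p)) = p \<bullet> (S *v p)"
    by (simp add: S_def inner_mult_transpose_eq[of p] inner_mult_transpose_eq[of _ \<Omega>]
        matrix_transpose_mul tH flip: matrix_vector_mul_assoc)
  then have Hp: "H *v (\<Omega> *v p) = 0"
    using psd_mat_kernel[OF H] Sp by simp
  have "p \<bullet> b = (H *v (\<Omega> *v p)) \<bullet> x"
    by (simp add: b_def inner_mult_transpose_eq tH)
  then have pb: "p \<bullet> b = 0" using Hp by simp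
  have "p \<bullet> ((S ** pinv S) *v b) = ((S ** pinv S) *v p) \<bullet> b"
    by (simp add: inner_mult_transpose_eq SX)
  also have "(S ** pinv S) *v p = 0"
    using Sp by (simp add: pi(3) flip: matrix_vector_mul_assoc)
  finally have "p \<bullet> p = 0"
    using pb by (subst (2) p_def) (simp add: inner_diff_right)
  then have proj: "(S ** pinv S) *v b = b" by (simp add: p_def)
  define c where "c = pinv S *v b"
  define r where "r = x - \<Omega> *v c"
  have r0: "transpose \<Omega> *v (H *v r) = 0"
    using proj by (simp add: r_def c_def S_def b_def matrix_vector_mult_diff_distrib
        matrix_vector_mul_assoc matrix_mul_assoc)
  have "x \<bullet> (nystrom H \<Omega> *v x) = x \<bullet> (H *v (\<Omega> *v c))"
    by (simp add: nystrom_def c_def b_def S_def matrix_transpose_mul tH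
        matrix_vector_mul_assoc matrix_mul_assoc)
  then have "x \<bullet> (H *v x) - x \<bullet> (nystrom H \<Omega> *v x) = x \<bullet> (H *v r)"
    by (simp add: r_def matrix_vector_mult_diff_distrib inner_diff_right)
  moreover have "r \<bullet> (H *v r) = x \<bullet> (H *v r)"
  proof -
    have "(\<Omega> *v c) \<bullet> (H *v r) = c \<bullet> (transpose \<Omega> *v (H *v r))"
      by (simp add: inner_mult_transpose_eq)
    then show ?thesis using r0 by (simp add: r_def inner_diff_left)
  qed
  ultimately show thesis using r0 that by metis
qed

lemma nystrom_le:
  fixes H :: "real^'d^'d" and \<Omega> :: "real^'s^'d"
  assumes H: "psd_mat H"
  shows "x \<bullet> (nystrom H \<Omega> *v x) \<le> x \<bullet> (H *v x)"
proof -
  obtain r where "x \<bullet> (H *v x) - x \<bullet> (nystrom H \<Omega> *v x) = r \<bullet> (H *v r)"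
    using nystrom_residual[OF H] by metis
  moreover have "r \<bullet> (H *v r) \<ge> 0" using H by (simp add: psd_mat_def)
  ultimately show ?thesis by linarith
qed

text \<open>With \<open>y = H *v r\<close> the kernel hypothesis rearranges to
  \<open>y \<bullet> y \<le> C * E\<close>. Cauchy-Schwarz on \<open>E = x \<bullet> y\<close> then
  gives \<open>E\<^sup>2 \<le> (x \<bullet> x) * (C * E)\<close>, and one factor \<open>E\<close>
  cancels.\<close>

lemma nystrom_error_bound:
  fixes H :: "real^'d^'d" and \<Omega> :: "real^'s^'d"
  assumes H: "psd_mat H" and \<eta>: "0 \<le> \<eta>" "\<eta> < 1" and "0 \<le> \<rho>"
    and ker: "\<And>v. transpose \<Omega> *v (H *v v) = 0 \<Longrightarrow>
       (H *v v) \<bullet> (H *v v) \<le> \<eta> * ((H *v v) \<bullet> (H *v v) + \<rho> * (v \<bullet> (H *v v)))"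
  shows "x \<bullet> (H *v x) - x \<bullet> (nystrom H \<Omega> *v x) \<le> \<eta> * \<rho> / (1 - \<eta>) * (x \<bullet> x)"
proof -
  obtain r where r: "transpose \<Omega> *v (H *v r) = 0"
    "x \<bullet> (H *v x) - x \<bullet> (nystrom H \<Omega> *v x) = r \<bullet> (H *v r)"
    "r \<bullet> (H *v r) = x \<bullet> (H *v r)"
    using nystrom_residual[OF H] by metis
  define E where "E = r \<bullet> (H *v r)"
  define y where "y = H *v r"
  define C where "C = \<eta> * \<rho> / (1 - \<eta>)"
  have E0: "E \<ge> 0" using H by (simp add: psd_mat_def E_def)
  have "(1 - \<eta>) * (y \<bullet> y) \<le> \<eta> * \<rho> * E"
    using ker[OF r(1)] by (simp add: E_def y_def algebra_simps)
  then have yC: "y \<bullet> y \<le> C * E"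
    using \<eta> by (simp add: C_def field_simps)
  have "E \<le> C * (x \<bullet> x)"
  proof (cases "E = 0")
    case True
    then show ?thesis using \<eta> \<open>0 \<le> \<rho>\<close> by (simp add: C_def)
  next
    case False
    then have E: "E > 0" using E0 by simp
    have "E\<^sup>2 = (x \<bullet> y)\<^sup>2" by (simp add: E_def r(3) y_def)
    also have "\<dots> \<le> (x \<bullet> x) * (y \<bullet> y)" by (rule Cauchy_Schwarz_ineq)
    also have "\<dots> \<le> (x \<bullet> x) * (C * E)" using yC by (intro mult_left_mono) auto
    finally show ?thesis using E by (simp add: power2_eq_square mult_ac)
  qed
  then show ?thesis using r(2) by (simp add: E_def C_def)
qed


text \<open>Bessel's inequality: the residual \<open>x - U *v (transpose U *v x)\<close> has
  nonnegative squared norm.\<close>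

lemma norm_transpose_orthonormal_le:
  fixes U :: "real^'s^'d"
  assumes U: "transpose U ** U = mat 1"
  shows "(transpose U *v x) \<bullet> (transpose U *v x) \<le> x \<bullet> x"
proof -
  let ?y = "transpose U *v x"
  have "(U *v ?y) \<bullet> (U *v ?y) = ?y \<bullet> ((transpose U ** U) *v ?y)"
    by (simp add: inner_mult_transpose_eq flip: matrix_vector_mul_assoc)
  then have "(x - U *v ?y) \<bullet> (x - U *v ?y) = x \<bullet> x - ?y \<bullet> ?y"
    using U by (simp add: inner_diff_left inner_diff_right inner_mult_transpose_eq[of x U]
        inner_commute[of "U *v ?y" x])
  then show ?thesis using inner_ge_zero[of "x - U *v ?y"] by linarith
qed

lemma diag_quadratic_form:
  fixes \<Lambda> :: "real^'s^'s"
  assumes "\<And>i j. i \<noteq> j \<Longrightarrow> \<Lambda> $ i $ j = 0"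
  shows "y \<bullet> (\<Lambda> *v y) = (\<Sum>i\<in>UNIV. \<Lambda> $ i $ i * (y $ i)\<^sup>2)"
proof -
  have "(\<Lambda> *v y) $ i = \<Lambda> $ i $ i * y $ i" for i
    using assms unfolding matrix_vector_mult_def
    by (simp add: sum.remove[of UNIV i])
  then show ?thesis
    by (simp add: inner_vec_def power2_eq_square mult_ac)
qed

lemma diag_min_le: "diag_min \<Lambda> \<le> \<Lambda> $ i $ i"
  unfolding diag_min_def by (rule Min_le) auto

lemma diag_min_nonneg: "(\<And>i. 0 \<le> \<Lambda> $ i $ i) \<Longrightarrow> 0 \<le> diag_min \<Lambda>"
  unfolding diag_min_def by (intro Min.boundedI) auto

lemma diag_min_quadratic_form_le:
  fixes \<Lambda> :: "real^'s^'s"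
  assumes "\<And>i j. i \<noteq> j \<Longrightarrow> \<Lambda> $ i $ j = 0"
  shows "diag_min \<Lambda> * (y \<bullet> y) \<le> y \<bullet> (\<Lambda> *v y)"
proof -
  have "diag_min \<Lambda> * (y \<bullet> y) = (\<Sum>i\<in>UNIV. diag_min \<Lambda> * (y $ i)\<^sup>2)"
    by (simp add: inner_vec_def sum_distrib_left power2_eq_square)
  also have "\<dots> \<le> (\<Sum>i\<in>UNIV. \<Lambda> $ i $ i * (y $ i)\<^sup>2)"
    by (intro sum_mono mult_right_mono diag_min_le) auto
  finally show ?thesis by (simp add: diag_quadratic_form[OF assms])
qed

section \<open>Effective dimension\<close>

lemma eff_dim_spectral:
  fixes H :: "real^'d^'d"
  assumes H: "psd_mat H" and \<rho>: "\<rho> > 0"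
    and e: "orthonormal_family e" and l: "\<And>j. H *v e j = l j *\<^sub>R e j"
  shows "eff_dim H \<rho> = (\<Sum>j\<in>UNIV. l j / (l j + \<rho>))" "l j \<ge> 0"
proof -
  show l0: "l j \<ge> 0" for j
  proof -
    have "0 \<le> e j \<bullet> (H *v e j)" using H by (simp add: psd_mat_def)
    then show ?thesis using e by (simp add: l orthonormal_family_def)
  qed
  define R where "R = H + \<rho> *\<^sub>R mat 1"
  have R: "R *v e j = (l j + \<rho>) *\<^sub>R e j" for j
    by (simp add: R_def matrix_vector_mult_add_rdistrib matrix_mult_scaleR_left l algebra_simps)
  obtain X :: "real^'d^'d" where X: "\<And>j. X *v e j = inverse (l j + \<rho>) *\<^sub>R e j"
    using spectral_matrix[OF e, of "\<lambda>j. inverse (l j + \<rho>)"] by blast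
  have ne: "l j + \<rho> \<noteq> 0" for j using l0[of j] \<rho> by simp
  have RX: "R ** X = mat 1"
    by (intro matrix_eqI_orthonormal[OF e])
      (simp add: X R matrix_vector_mult_scaleR ne flip: matrix_vector_mul_assoc)
  then have "matrix_inv R = X" by (rule matrix_inv_eqI)
  then have "eff_dim H \<rho> = trace (H ** X)"
    by (simp add: eff_dim_def R_def)
  also have "\<dots> = (\<Sum>j\<in>UNIV. l j / (l j + \<rho>))"
    using e by (subst trace_orthonormal[OF e])
      (simp add: X l matrix_vector_mult_scaleR orthonormal_family_def divide_inverse mult_ac
        flip: matrix_vector_mul_assoc)
  finally show "eff_dim H \<rho> = (\<Sum>j\<in>UNIV. l j / (l j + \<rho>))" .
qed

text \<open>The hypothesis says that \<open>H\<close> dominates \<open>m\<close> times the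
  projection onto the columns of \<open>U\<close>, and each of these orthonormal columns contributes
  at least \<open>m / (m + \<rho>)\<close> to the trace. The proof bounds the resolvent on each
  column directly instead of invoking operator monotonicity.\<close>

lemma eff_dim_lower_bound:
  fixes H :: "real^'d^'d" and U :: "real^'s^'d"
  assumes H: "psd_mat H" and \<rho>: "\<rho> > 0" and m: "m \<ge> 0"
    and U: "transpose U ** U = mat 1"
    and dom: "\<And>x. m * ((transpose U *v x) \<bullet> (transpose U *v x)) \<le> x \<bullet> (H *v x)"
  shows "real CARD('s) * (m / (m + \<rho>)) \<le> eff_dim H \<rho>"
proof -
  obtain e l where e: "orthonormal_family e" and l: "\<And>j. H *v e j = l j *\<^sub>R e j"
    using symmetric_eigenbasis[of H] H by (auto simp: psd_mat_def)
  note eff = eff_dim_spectral[OF H \<rho> e l]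
  define k where "k j = l j / (l j + \<rho>)" for j
  have pos: "l j + \<rho> > 0" for j using eff(2)[of j] \<rho> by simp
  have k0: "k j \<ge> 0" for j
    unfolding k_def using eff(2)[of j] \<rho> by simp
  define u where "u i = column i U" for i
  have uU: "u i \<bullet> x = (transpose U *v x) $ i" for i x
    by (simp add: u_def matrix_vector_mul_component transpose_def column_def inner_vec_def)
  have uu: "u i \<bullet> u i = 1" for i
    using arg_cong[OF U, of "\<lambda>A. A $ i $ i"]
    by (simp add: matrix_mult_transpose_dot_column mat_def u_def)
  have each: "m / (m + \<rho>) \<le> (\<Sum>j\<in>UNIV. k j * (u i \<bullet> e j)\<^sup>2)" for i
  proof -
    \<comment> \<open>This is the resolvent of \<open>H\<close> at \<open>\<rho>\<close> applied to
      column \<open>u i\<close>. Pairing \<open>Hw\<close> with \<open>w\<close> yields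
      \<open>(m + \<rho>) * c\<^sup>2 \<le> c\<close>, because both squared norms of
      \<open>w\<close> and \<open>transpose U *v w\<close> are at least
      \<open>c\<^sup>2\<close>.\<close>
    define w where "w = (\<Sum>j\<in>UNIV. ((u i \<bullet> e j) / (l j + \<rho>)) *\<^sub>R e j)"
    have we: "w \<bullet> e j = (u i \<bullet> e j) / (l j + \<rho>)" for j
      unfolding w_def by (rule inner_orthonormal_sum[OF e])
    have Hw: "H *v w + \<rho> *\<^sub>R w = u i"
    proof (rule orthonormal_eqI[OF e])
      fix j
      have "(H *v w) \<bullet> e j = l j * (w \<bullet> e j)"
        using H l by (simp add: psd_mat_def flip: sym_mat_inner)
      then have "(H *v w + \<rho> *\<^sub>R w) \<bullet> e j = (l j + \<rho>) * (w \<bullet> e j)"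
        by (simp add: inner_add_left algebra_simps)
      then show "(H *v w + \<rho> *\<^sub>R w) \<bullet> e j = u i \<bullet> e j"
        using pos[of j] by (simp add: we)
    qed
    define c where "c = u i \<bullet> w"
    have "c\<^sup>2 \<le> w \<bullet> w"
      using Cauchy_Schwarz_ineq[of "u i" w] uu[of i] by (simp add: c_def)
    moreover have "c\<^sup>2 \<le> (transpose U *v w) \<bullet> (transpose U *v w)"
      using member_le_sum[of i UNIV "\<lambda>i. ((transpose U *v w) $ i)\<^sup>2"]
      by (simp add: c_def uU inner_vec_def[of "transpose U *v w"] power2_eq_square)
    then have "m * c\<^sup>2 \<le> w \<bullet> (H *v w)"
      using dom[of w] m by (meson mult_left_mono order_trans)
    moreover have c: "w \<bullet> (H *v w) + \<rho> * (w \<bullet> w) = c"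
      unfolding c_def by (subst Hw[symmetric]) (simp add: inner_add_right inner_commute)
    ultimately have "m * c\<^sup>2 + \<rho> * c\<^sup>2 \<le> c"
      using mult_left_mono[of "c\<^sup>2" "w \<bullet> w" \<rho>] \<rho> by linarith
    then have "(m + \<rho>) * c\<^sup>2 \<le> c"
      by (simp add: distrib_right)
    then have "((m + \<rho>) * c) * c \<le> 1 * c"
      by (simp add: power2_eq_square)
    then have "(m + \<rho>) * c \<le> 1"
      using m \<rho> by (cases "c > 0") (auto simp: mult_nonneg_nonpos not_less intro: order_trans[of _ 0])
    then have c: "c \<le> 1 / (m + \<rho>)"
      using m \<rho> by (simp add: field_simps)
    \<comment> \<open>Here \<open>k j = 1 - \<rho> / (l j + \<rho>)\<close>, so an upper bound on
      the resolvent becomes a lower bound on this form.\<close>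
    have "(\<Sum>j\<in>UNIV. k j * (u i \<bullet> e j)\<^sup>2) = (\<Sum>j\<in>UNIV. (u i \<bullet> e j)\<^sup>2 - \<rho> * ((u i \<bullet> e j) * (w \<bullet> e j)))"
      using pos by (intro sum.cong refl) (simp add: k_def we field_simps power2_eq_square less_imp_neq[THEN not_sym])
    also have "\<dots> = 1 - \<rho> * c"
      using uu[of i] parseval[OF e, of "u i" "u i"] parseval[OF e, of "u i" w]
      by (simp add: sum_subtractf c_def power2_eq_square flip: sum_distrib_left)
    finally have "(\<Sum>j\<in>UNIV. k j * (u i \<bullet> e j)\<^sup>2) = 1 - \<rho> * c" .
    moreover have "\<rho> * c \<le> \<rho> * (1 / (m + \<rho>))" using c \<rho> by (intro mult_left_mono) auto
    moreover have "m / (m + \<rho>) = 1 - \<rho> * (1 / (m + \<rho>))" using m \<rho> by (simp add: field_simps)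
    ultimately show ?thesis by linarith
  qed
  have "real CARD('s) * (m / (m + \<rho>)) = (\<Sum>i\<in>(UNIV::'s set). m / (m + \<rho>))" by simp
  also have "\<dots> \<le> (\<Sum>i\<in>UNIV. \<Sum>j\<in>UNIV. k j * (u i \<bullet> e j)\<^sup>2)"
    by (rule sum_mono) (rule each)
  also have "\<dots> = (\<Sum>j\<in>UNIV. k j * ((transpose U *v e j) \<bullet> (transpose U *v e j)))"
    by (subst sum.swap) (simp add: uU inner_vec_def[of "transpose U *v e _"] power2_eq_square flip: sum_distrib_left)
  also have "\<dots> \<le> (\<Sum>j\<in>UNIV. k j * (e j \<bullet> e j))"
    using k0 norm_transpose_orthonormal_le[OF U] by (intro sum_mono mult_left_mono) auto
  also have "\<dots> = eff_dim H \<rho>"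
    using e by (simp add: eff(1) k_def orthonormal_family_def)
  finally show ?thesis .
qed

section \<open>Condition numbers and quadratic forms\<close>

lemma cond2_le:
  fixes M :: "real^'n^'n"
  assumes M: "sym_mat M" and a: "a > 0"
    and bounds: "\<And>c. c \<in> eigenvalues M \<Longrightarrow> a \<le> c \<and> c \<le> K * a"
  shows "cond2 M \<le> K"
proof -
  obtain e l where e: "orthonormal_family e" and l: "\<And>j. M *v e j = l j *\<^sub>R e j"
    using symmetric_eigenbasis[OF M] by auto
  have "eigenvalues M = range l" by (rule eigenvalues_eq_range[OF e l M])
  then have fin: "finite (eigenvalues M)" "eigenvalues M \<noteq> {}" by auto
  have *: "Min (eigenvalues M) \<in> eigenvalues M" "Max (eigenvalues M) \<in> eigenvalues M"
    using fin by auto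
  have "Max (eigenvalues M) \<le> K * a" "a \<le> Min (eigenvalues M)"
    using bounds * by auto
  moreover have "K \<ge> 0"
    using bounds[OF *(1)] a by (smt (verit) mult_nonneg_nonneg mult_neg_pos)
  ultimately have "Max (eigenvalues M) \<le> K * Min (eigenvalues M)"
    by (meson mult_left_mono order_trans)
  then show ?thesis
    using \<open>a \<le> Min (eigenvalues M)\<close> a by (simp add: cond2_def divide_simps)
qed

text \<open>Substituting \<open>w = X *v v\<close>, where \<open>X\<close> is the inverse square
  root of \<open>P\<close>, turns an eigenvalue equation for the preconditioned matrix into
  \<open>R *v w = c *\<^sub>R (P *v w)\<close>. So \<open>c\<close> is the ratio of two quadratic
  forms, which the hypotheses control.\<close>

lemma cond2_preconditioned_le:
  fixes P R :: "real^'n^'n"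
  assumes P: "pd_mat P" and R: "sym_mat R" and a: "a > 0"
    and lower: "\<And>w. a * (w \<bullet> (P *v w)) \<le> w \<bullet> (R *v w)"
    and upper: "\<And>w. w \<bullet> (R *v w) \<le> K * a * (w \<bullet> (P *v w))"
  shows "cond2 (mat_inv_sqrt P ** R ** mat_inv_sqrt P) \<le> K"
proof -
  define S where "S = mat_sqrt P"
  have "psd_mat P"
    using P by (auto simp: pd_mat_def psd_mat_def) (metis inner_zero_left less_imp_le order_refl)
  then have S: "psd_mat S" "S ** S = P"
    unfolding S_def by (rule mat_sqrt_properties)+
  have "w = 0" if "S *v w = 0" for w
  proof -
    have "P *v w = 0" using that S(2) by (metis matrix_vector_mul_assoc matrix_vector_mult_0_right)
    then show ?thesis using P by (force simp: pd_mat_def)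
  qed
  then obtain X where X: "S ** X = mat 1" "X ** S = mat 1"
    using matrix_left_invertible_ker[of S] matrix_left_right_inverse by blast
  have tS: "transpose S = S" using S by (simp add: psd_mat_def sym_mat_def)
  have "S ** transpose X = mat 1"
    using arg_cong[OF X(2), of transpose] by (simp add: matrix_transpose_mul tS)
  then have tX: "transpose X = X"
    using X by (metis matrix_mul_assoc matrix_mul_lid matrix_mul_rid)
  have "mat_inv_sqrt P = X" using matrix_inv_eqI[OF X(1)] by (simp add: mat_inv_sqrt_def S_def)
  moreover have "cond2 (X ** R ** X) \<le> K"
  proof (rule cond2_le[OF _ a])
    show "sym_mat (X ** R ** X)"
      using R by (simp add: sym_mat_def matrix_transpose_mul tX matrix_mul_assoc)
    fix c assume "c \<in> eigenvalues (X ** R ** X)"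
    then obtain v where v: "v \<noteq> 0" "(X ** R ** X) *v v = c *\<^sub>R v"
      by (auto simp: eigenvalues_def)
    define w where "w = X *v v"
    have vw: "v = S *v w"
      by (simp add: w_def matrix_vector_mul_assoc X)
    have "w \<noteq> 0" using v(1) vw by auto
    have "R *v w = S *v ((X ** R ** X) *v v)"
      by (simp add: w_def matrix_vector_mul_assoc matrix_mul_assoc X)
    also have "\<dots> = c *\<^sub>R (P *v w)"
      by (simp add: v(2)) (simp add: vw matrix_vector_mult_scaleR matrix_vector_mul_assoc S)
    finally have eq: "w \<bullet> (R *v w) = c * (w \<bullet> (P *v w))" by simp
    moreover have "w \<bullet> (P *v w) > 0" using P \<open>w \<noteq> 0\<close> by (simp add: pd_mat_def)
    ultimately show "a \<le> c \<and> c \<le> K * a"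
      using lower[of w] upper[of w] by simp
  qed
  ultimately show ?thesis by simp
qed

text \<open>Write \<open>N\<close> for the Nystroem approximation and \<open>m\<close> for its
  smallest retained eigenvalue. In the sense of quadratic forms,
  \<open>\<rho> * P \<le> N + \<rho> * I \<le> H + \<rho> * I\<close>. Conversely
  \<open>N + \<rho> * I \<le> (m + \<rho>) * P\<close>, and the error costs
  \<open>C * \<rho> * I \<le> C * \<rho> * P\<close> because \<open>I \<le> P\<close>.\<close>

lemma nystrom_precond_cond2:
  fixes H :: "real^'d^'d" and \<Omega> U :: "real^'s^'d"
  assumes H: "psd_mat H" and \<rho>: "\<rho> > 0" and eig: "nystrom_eig H \<Omega> U \<Lambda>"
    and err: "\<And>x. x \<bullet> (H *v x) - x \<bullet> (nystrom H \<Omega> *v x) \<le> C * \<rho> * (x \<bullet> x)"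
    and C: "C \<ge> 0" "diag_min \<Lambda> \<le> B * \<rho>"
  shows "cond2 (mat_inv_sqrt (nystrom_precond \<rho> U \<Lambda>) ** (H + \<rho> *\<^sub>R mat 1)
            ** mat_inv_sqrt (nystrom_precond \<rho> U \<Lambda>)) \<le> 1 + B + C"
proof -
  let ?P = "nystrom_precond \<rho> U \<Lambda>"
  define m where "m = diag_min \<Lambda>"
  have U: "transpose U ** U = mat 1" and diag: "\<And>i j. i \<noteq> j \<Longrightarrow> \<Lambda> $ i $ j = 0"
    and nonneg: "\<And>i. 0 \<le> \<Lambda> $ i $ i" and ny: "nystrom H \<Omega> = U ** \<Lambda> ** transpose U"
    using eig by (auto simp: nystrom_eig_def)
  have m0: "m \<ge> 0" unfolding m_def using nonneg by (rule diag_min_nonneg)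
  define t where "t w = transpose U *v w" for w
  define q where "q w = t w \<bullet> (\<Lambda> *v t w)" for w
  have nyq: "w \<bullet> (nystrom H \<Omega> *v w) = q w" for w
    by (simp add: ny q_def t_def inner_mult_transpose_eq[of w U] flip: matrix_vector_mul_assoc)
  have tl: "t w \<bullet> t w \<le> w \<bullet> w" for w
    unfolding t_def by (rule norm_transpose_orthonormal_le[OF U])
  have qm: "m * (t w \<bullet> t w) \<le> q w" for w
    unfolding m_def q_def by (rule diag_min_quadratic_form_le[OF diag])
  have Pw: "w \<bullet> (?P *v w) = (q w + \<rho> * (t w \<bullet> t w)) / (m + \<rho>) + (w \<bullet> w - t w \<bullet> t w)" for w
    by (simp add: nystrom_precond_def m_def[symmetric] q_def t_def matrix_vector_mult_add_rdistrib
        matrix_vector_mult_diff_rdistrib matrix_mult_scaleR_left inner_add_right inner_diff_right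
        inner_mult_transpose_eq[of w U] flip: matrix_vector_mul_assoc)
  have PI: "w \<bullet> w \<le> w \<bullet> (?P *v w)" for w
  proof -
    have "t w \<bullet> t w \<le> (q w + \<rho> * (t w \<bullet> t w)) / (m + \<rho>)"
      using qm[of w] m0 \<rho> by (simp add: field_simps)
    then show ?thesis by (simp add: Pw)
  qed
  have "transpose \<Lambda> = \<Lambda>"
    using diag by (simp add: vec_eq_iff transpose_def) metis
  then have "sym_mat ?P"
    by (simp add: sym_mat_def nystrom_precond_def transpose_add transpose_diff transpose_scalar
        matrix_transpose_mul matrix_mul_assoc)
  then have pd: "pd_mat ?P"
    using PI by (auto simp: pd_mat_def) (metis inner_gt_zero_iff less_le_trans)
  have Hs: "sym_mat H" using H by (simp add: psd_mat_def)
  have Hr: "w \<bullet> ((H + \<rho> *\<^sub>R mat 1) *v w) = w \<bullet> (H *v w) + \<rho> * (w \<bullet> w)" for w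
    by (simp add: matrix_vector_mult_add_rdistrib matrix_mult_scaleR_left inner_add_right)
  have P': "(m + \<rho>) * (w \<bullet> (?P *v w)) = q w + \<rho> * (t w \<bullet> t w) + (m + \<rho>) * (w \<bullet> w - t w \<bullet> t w)" for w
    using m0 \<rho> by (simp add: Pw field_simps)
  show ?thesis
  proof (rule cond2_preconditioned_le[OF pd _ \<rho>])
    show "sym_mat (H + \<rho> *\<^sub>R mat 1)"
      using Hs by (simp add: sym_mat_def transpose_def vec_eq_iff mat_def)
    fix w
    show "\<rho> * (w \<bullet> (?P *v w)) \<le> w \<bullet> ((H + \<rho> *\<^sub>R mat 1) *v w)"
    proof -
      define Y where "Y = \<rho> / (m + \<rho>) * (q w + \<rho> * (t w \<bullet> t w))"
      have "Y \<le> 1 * (q w + \<rho> * (t w \<bullet> t w))"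
        unfolding Y_def using m0 \<rho> order_trans[OF mult_nonneg_nonneg qm[of w]]
        by (intro mult_right_mono add_nonneg_nonneg) auto
      moreover have "\<rho> * (w \<bullet> (?P *v w)) = Y + \<rho> * (w \<bullet> w) - \<rho> * (t w \<bullet> t w)"
        unfolding Pw Y_def by (simp add: distrib_left[of \<rho>] right_diff_distrib)
      ultimately have "\<rho> * (w \<bullet> (?P *v w)) \<le> q w + \<rho> * (w \<bullet> w)"
        by (simp only: mult_1)
      then show ?thesis
        using nystrom_le[OF H, of w \<Omega>] by (simp add: Hr nyq)
    qed
    show "w \<bullet> ((H + \<rho> *\<^sub>R mat 1) *v w) \<le> (1 + B + C) * \<rho> * (w \<bullet> (?P *v w))"
    proof -
      have "w \<bullet> ((H + \<rho> *\<^sub>R mat 1) *v w) \<le> q w + \<rho> * (w \<bullet> w) + C * \<rho> * (w \<bullet> w)"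
        using err[of w] by (simp add: Hr nyq)
      \<comment> \<open>The two sides differ by \<open>m\<close> times the squared norm of
        \<open>w\<close> outside the range of \<open>U\<close>.\<close>
      also have "q w + \<rho> * (w \<bullet> w) \<le> (m + \<rho>) * (w \<bullet> (?P *v w))"
        using P'[of w] mult_left_mono[OF tl[of w] m0] by (simp add: algebra_simps)
      also have "\<dots> \<le> (B * \<rho> + \<rho>) * (w \<bullet> (?P *v w))"
        using C order_trans[OF inner_ge_zero PI[of w]] by (intro mult_right_mono) (auto simp: m_def)
      also have "C * \<rho> * (w \<bullet> w) \<le> C * \<rho> * (w \<bullet> (?P *v w))"
        using C \<rho> PI by (intro mult_left_mono) auto
      finally show ?thesis by (simp add: algebra_simps)
    qed
  qed
qed

subsection \<open>Standard Gaussian vectors\<close>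

text \<open>The index type is arbitrary, so that one measure serves both the entries of the sketch,
  indexed by pairs, and auxiliary vectors.\<close>

definition std_gaussian :: "('i::finite \<Rightarrow> real) measure" where
  "std_gaussian = PiM UNIV (\<lambda>_. std_normal_distribution)"

lemma prob_space_std_normal: "prob_space std_normal_distribution"
  by (rule prob_space_normal_density) simp

interpretation std_normal: prob_space std_normal_distribution
  by (rule prob_space_std_normal)

interpretation std_normal_product: product_prob_space "\<lambda>_. std_normal_distribution" I for I
  by standard

lemma sets_std_gaussian [measurable_cong]: "sets std_gaussian = sets (PiM UNIV (\<lambda>_. borel))"
  unfolding std_gaussian_def by (intro sets_PiM_cong) auto

lemma space_std_gaussian [simp]: "space std_gaussian = UNIV"
  by (simp add: std_gaussian_def space_PiM)

lemma prob_space_std_gaussian: "prob_space std_gaussian"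
  unfolding std_gaussian_def by (rule std_normal_product.prob_space_axioms)

interpretation std_gaussian: prob_space std_gaussian
  by (rule prob_space_std_gaussian)

lemma nn_integral_normal_density: "\<sigma> > 0 \<Longrightarrow> (\<integral>\<^sup>+x. normal_density \<mu> \<sigma> x \<partial>lborel) = 1"
  using prob_space.emeasure_space_1[OF prob_space_normal_density[of \<sigma> \<mu>]]
  by (simp add: emeasure_density)

text \<open>Up to the factor \<open>\<sigma>\<close>, the integrand is the normal density of
  variance \<open>1 / (1 - 2 * b)\<close>.\<close>

lemma std_normal_exp_square:
  assumes "b < 1/2"
  shows "(\<integral>\<^sup>+x. exp (b * x\<^sup>2) \<partial>std_normal_distribution) = ennreal (1 / sqrt (1 - 2 * b))"
proof -
  define \<sigma> where "\<sigma> = 1 / sqrt (1 - 2 * b)"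
  have \<sigma>: "\<sigma> > 0" "\<sigma>\<^sup>2 = 1 / (1 - 2 * b)"
    using assms by (auto simp: \<sigma>_def power_divide)
  have dens: "std_normal_density x * exp (b * x\<^sup>2) = \<sigma> * normal_density 0 \<sigma> x" for x
  proof -
    have "sqrt (2 * pi * \<sigma>\<^sup>2) = sqrt (2 * pi) * \<sigma>"
      using \<sigma>(1) by (simp add: real_sqrt_mult)
    moreover have "- x\<^sup>2 / 2 + b * x\<^sup>2 = - x\<^sup>2 / (2 * \<sigma>\<^sup>2)"
      using assms by (simp add: \<sigma>(2) field_simps)
    ultimately show ?thesis
      using \<sigma> by (simp add: normal_density_def exp_add[symmetric])
  qed
  have "(\<integral>\<^sup>+x. exp (b * x\<^sup>2) \<partial>std_normal_distribution) = (\<integral>\<^sup>+x. ennreal \<sigma> * normal_density 0 \<sigma> x \<partial>lborel)"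
    using \<sigma> by (subst nn_integral_density) (auto intro!: nn_integral_cong simp: dens simp flip: ennreal_mult')
  also have "\<dots> = ennreal \<sigma>"
    using \<sigma> by (subst nn_integral_cmult) (auto simp: nn_integral_normal_density)
  finally show ?thesis by (simp add: \<sigma>_def)
qed

lemma std_normal_exp_linear:
  "(\<integral>\<^sup>+x. exp (c * x) \<partial>std_normal_distribution) = ennreal (exp (c\<^sup>2 / 2))"
proof -
  have dens: "std_normal_density x * exp (c * x) = exp (c\<^sup>2 / 2) * normal_density c 1 x" for x
  proof -
    have "- x\<^sup>2 / 2 + c * x = c\<^sup>2 / 2 + - (x - c)\<^sup>2 / 2"
      by (simp add: power2_eq_square field_simps)
    then have "exp (- x\<^sup>2 / 2) * exp (c * x) = exp (c\<^sup>2 / 2) * exp (- (x - c)\<^sup>2 / 2)"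
      by (simp only: exp_add[symmetric])
    then show ?thesis
      by (simp add: normal_density_def)
  qed
  have "(\<integral>\<^sup>+x. exp (c * x) \<partial>std_normal_distribution) =
      (\<integral>\<^sup>+x. ennreal (exp (c\<^sup>2 / 2)) * normal_density c 1 x \<partial>lborel)"
    by (subst nn_integral_density) (auto intro!: nn_integral_cong simp: dens simp flip: ennreal_mult')
  then show ?thesis
    by (simp add: nn_integral_cmult nn_integral_normal_density)
qed

text \<open>The exponential weight is the ratio of the standard normal densities at
  \<open>x + h\<close> and at \<open>x\<close>.\<close>

lemma std_normal_shift:
  fixes h :: real
  assumes [measurable]: "A \<in> sets borel"
  shows "(\<integral>\<^sup>+x. ennreal (exp (- (h * x) - h\<^sup>2 / 2)) * indicator A (x + h) \<partial>std_normal_distribution)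
    = emeasure std_normal_distribution A"
proof -
  have dens: "std_normal_density x * exp (- (h * x) - h\<^sup>2 / 2) = std_normal_density (h + 1 * x)" for x
  proof -
    have "- x\<^sup>2 / 2 + (- (h * x) - h\<^sup>2 / 2) = - (h + x)\<^sup>2 / 2"
      by (simp add: power2_eq_square field_simps)
    then have "exp (- x\<^sup>2 / 2) * exp (- (h * x) - h\<^sup>2 / 2) = exp (- (h + x)\<^sup>2 / 2)"
      by (simp only: exp_add[symmetric])
    then show ?thesis by (simp add: normal_density_def)
  qed
  have dens': "ennreal (std_normal_density x) * (ennreal (exp (- (h * x) - h\<^sup>2 / 2)) * indicator A (x + h))
      = ennreal (std_normal_density (h + 1 * x)) * indicator A (h + 1 * x)" for x
  proof -
    have "ennreal (std_normal_density (h + 1 * x)) = ennreal (std_normal_density x) * ennreal (exp (- (h * x) - h\<^sup>2 / 2))"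
      by (simp only: dens[symmetric] ennreal_mult' normal_density_nonneg)
    moreover have "h + 1 * x = x + h" by simp
    ultimately show ?thesis by (simp only: mult.assoc)
  qed
  have "(\<integral>\<^sup>+x. ennreal (exp (- (h * x) - h\<^sup>2 / 2)) * indicator A (x + h) \<partial>std_normal_distribution)
    = (\<integral>\<^sup>+x. ennreal (std_normal_density (h + 1 * x)) * indicator A (h + 1 * x) \<partial>lborel)"
    by (subst nn_integral_density) (simp_all only: dens', measurable)
  also have "\<dots> = (\<integral>\<^sup>+x. ennreal (std_normal_density x) * indicator A x \<partial>lborel)"
    using nn_integral_real_affine[of "\<lambda>x. ennreal (std_normal_density x) * indicator A x" 1 h] by simp
  also have "\<dots> = emeasure std_normal_distribution A"
    by (simp add: emeasure_density)
  finally show ?thesis .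
qed

lemma nn_integral_std_gaussian_prod:
  assumes "\<And>i. f i \<in> borel_measurable borel"
  shows "(\<integral>\<^sup>+\<xi>. (\<Prod>i\<in>UNIV. f i (\<xi> i)) \<partial>std_gaussian) = (\<Prod>i\<in>UNIV. \<integral>\<^sup>+x. f i x \<partial>std_normal_distribution)"
  unfolding std_gaussian_def using assms
  by (intro std_normal_product.product_nn_integral_prod) auto

text \<open>Under the weighted measure the translated vector is again standard Gaussian: the two
  laws agree on boxes, coordinate by coordinate, and boxes determine a product measure.\<close>

lemma cameron_martin:
  fixes h :: "'i::finite \<Rightarrow> real"
  assumes G [measurable]: "G \<in> borel_measurable std_gaussian"
  shows "(\<integral>\<^sup>+\<xi>. G \<xi> \<partial>std_gaussian) =
    (\<integral>\<^sup>+\<xi>. ennreal (exp (- (\<Sum>i\<in>UNIV. h i * \<xi> i) - (\<Sum>i\<in>UNIV. (h i)\<^sup>2) / 2)) * G (\<lambda>i. \<xi> i + h i) \<partial>std_gaussian)"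
proof -
  let ?w = "\<lambda>\<xi>. ennreal (exp (- (\<Sum>i\<in>UNIV. h i * \<xi> i) - (\<Sum>i\<in>UNIV. (h i)\<^sup>2) / 2))"
  let ?s = "\<lambda>\<xi> i. \<xi> i + h i"
  have [measurable]: "?s \<in> measurable std_gaussian std_gaussian"
    by (subst measurable_cong_sets[OF refl sets_std_gaussian]) (rule measurable_PiM_single'; simp; measurable)
  define P where "P = distr (density std_gaussian ?w) std_gaussian ?s"
  have w: "?w \<xi> = (\<Prod>i\<in>UNIV. ennreal (exp (- (h i * \<xi> i) - (h i)\<^sup>2 / 2)))" for \<xi>
    by (simp add: prod_ennreal exp_sum[symmetric] sum_subtractf sum_negf sum_divide_distrib)
  have "P = PiM UNIV (\<lambda>_. std_normal_distribution)"
  proof (rule std_normal_product.PiM_eqI)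
    show "sets P = sets (PiM UNIV (\<lambda>_. std_normal_distribution))"
      by (simp add: P_def std_gaussian_def)
    fix A :: "'i \<Rightarrow> real set" assume A: "\<And>i. i \<in> UNIV \<Longrightarrow> A i \<in> sets std_normal_distribution"
    have [measurable]: "A i \<in> sets borel" for i using A by auto
    have [measurable]: "Pi\<^sub>E UNIV A \<in> sets std_gaussian"
      unfolding std_gaussian_def using A by (intro sets_PiM_I_finite) auto
    have ind: "indicator (Pi\<^sub>E UNIV A) (?s \<xi>) = (\<Prod>i\<in>UNIV. indicator (A i) (\<xi> i + h i) :: ennreal)" for \<xi>
      by (auto simp: indicator_def PiE_iff)
    have "emeasure P (Pi\<^sub>E UNIV A) = (\<integral>\<^sup>+\<xi>. indicator (Pi\<^sub>E UNIV A) \<xi> \<partial>P)"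
      by (simp add: P_def)
    also have "\<dots> = (\<integral>\<^sup>+\<xi>. ?w \<xi> * indicator (Pi\<^sub>E UNIV A) (?s \<xi>) \<partial>std_gaussian)"
      unfolding P_def by (subst nn_integral_distr) (auto simp: nn_integral_density)
    also have "\<dots> = (\<integral>\<^sup>+\<xi>. (\<Prod>i\<in>UNIV. ennreal (exp (- (h i * \<xi> i) - (h i)\<^sup>2 / 2)) * indicator (A i) (\<xi> i + h i)) \<partial>std_gaussian)"
      by (simp only: w ind prod.distrib)
    also have "\<dots> = (\<Prod>i\<in>UNIV. emeasure std_normal_distribution (A i))"
      by (subst nn_integral_std_gaussian_prod) (simp_all add: std_normal_shift del: minus_mult_left)
    finally show "emeasure P (Pi\<^sub>E UNIV A) = (\<Prod>i\<in>UNIV. emeasure std_normal_distribution (A i))" .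
  qed simp
  then have "(\<integral>\<^sup>+\<xi>. G \<xi> \<partial>std_gaussian) = (\<integral>\<^sup>+\<xi>. G \<xi> \<partial>P)" by (simp add: std_gaussian_def)
  also have "\<dots> = (\<integral>\<^sup>+\<xi>. ?w \<xi> * G (?s \<xi>) \<partial>std_gaussian)"
    unfolding P_def by (subst nn_integral_distr) (auto simp: nn_integral_density)
  finally show ?thesis .
qed

text \<open>Variances of independent centered summands add, since all cross terms integrate to
  zero.\<close>

lemma std_gaussian_centered_sum_square:
  fixes \<phi> :: "'i::finite \<Rightarrow> real \<Rightarrow> real"
  assumes int: "\<And>i. integrable std_normal_distribution (\<phi> i)"
    and int2: "\<And>i. integrable std_normal_distribution (\<lambda>x. (\<phi> i x)\<^sup>2)"
    and mean: "\<And>i. (\<integral>x. \<phi> i x \<partial>std_normal_distribution) = 0"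
  shows "integrable std_gaussian (\<lambda>\<xi>. (\<Sum>i\<in>UNIV. \<phi> i (\<xi> i))\<^sup>2)"
    "(\<integral>\<xi>. (\<Sum>i\<in>UNIV. \<phi> i (\<xi> i))\<^sup>2 \<partial>std_gaussian) = (\<Sum>i\<in>UNIV. \<integral>x. (\<phi> i x)\<^sup>2 \<partial>std_normal_distribution)"
    "integrable std_gaussian (\<lambda>\<xi>. \<Sum>i\<in>UNIV. \<phi> i (\<xi> i))"
    "(\<integral>\<xi>. (\<Sum>i\<in>UNIV. \<phi> i (\<xi> i)) \<partial>std_gaussian) = 0"
proof -
  \<comment> \<open>Padding with ones writes a product of two coordinates as a product over all
    coordinates; for \<open>i = j\<close> the factor at that index is the square.\<close>
  define f where "f i j k x = (if k = i then \<phi> k x else 1) * (if k = j then \<phi> k x else 1)" for i j k x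
  have fint: "integrable std_normal_distribution (f i j k)" for i j k
    using int[of k] int2[of k] unfolding f_def by (cases "k = i"; cases "k = j") (simp_all add: power2_eq_square)
  have fprod: "(\<Prod>k\<in>UNIV. f i j k (\<xi> k)) = \<phi> i (\<xi> i) * \<phi> j (\<xi> j)" for i j \<xi>
    unfolding f_def by (simp add: prod.distrib)
  have pint: "integrable std_gaussian (\<lambda>\<xi>. \<phi> i (\<xi> i) * \<phi> j (\<xi> j))" for i j
    unfolding std_gaussian_def using std_normal_product.product_integrable_prod[of UNIV "f i j"] fint
    by (simp add: fprod)
  have pval: "(\<integral>\<xi>. \<phi> i (\<xi> i) * \<phi> j (\<xi> j) \<partial>std_gaussian) =
      (if i = j then \<integral>x. (\<phi> i x)\<^sup>2 \<partial>std_normal_distribution else 0)" for i j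
  proof -
    have "(\<integral>\<xi>. \<phi> i (\<xi> i) * \<phi> j (\<xi> j) \<partial>std_gaussian) = (\<Prod>k\<in>UNIV. \<integral>x. f i j k x \<partial>std_normal_distribution)"
      unfolding std_gaussian_def using std_normal_product.product_integral_prod[of UNIV "f i j"] fint
      by (simp add: fprod)
    also have "\<dots> = (if i = j then \<integral>x. (\<phi> i x)\<^sup>2 \<partial>std_normal_distribution else 0)"
    proof (cases "i = j")
      case True
      have "(\<integral>x. f i j k x \<partial>std_normal_distribution) =
          (if k = i then \<integral>x. (\<phi> k x)\<^sup>2 \<partial>std_normal_distribution else 1)" for k
        using True std_normal.prob_space by (simp add: f_def power2_eq_square)
      then show ?thesis using True by simp
    next
      case False
      then have "(\<integral>x. f i j i x \<partial>std_normal_distribution) = 0"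
        by (simp add: f_def mean)
      then have "(\<Prod>k\<in>UNIV. \<integral>x. f i j k x \<partial>std_normal_distribution) = 0"
        by (intro prod_zero) auto
      with False show ?thesis by simp
    qed
    finally show ?thesis .
  qed
  have sq: "(\<Sum>i\<in>UNIV. \<phi> i (\<xi> i))\<^sup>2 = (\<Sum>i\<in>UNIV. \<Sum>j\<in>UNIV. \<phi> i (\<xi> i) * \<phi> j (\<xi> j))" for \<xi>
    by (simp add: power2_eq_square sum_product)
  show "integrable std_gaussian (\<lambda>\<xi>. (\<Sum>i\<in>UNIV. \<phi> i (\<xi> i))\<^sup>2)"
    using pint by (simp add: sq)
  show "(\<integral>\<xi>. (\<Sum>i\<in>UNIV. \<phi> i (\<xi> i))\<^sup>2 \<partial>std_gaussian) = (\<Sum>i\<in>UNIV. \<integral>x. (\<phi> i x)\<^sup>2 \<partial>std_normal_distribution)"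
    using pint by (simp add: sq pval)
  define g where "g i k x = (if k = i then \<phi> k x else 1)" for i k x
  have gint: "integrable std_normal_distribution (g i k)" for i k
    using int[of k] unfolding g_def by (cases "k = i") simp_all
  have gprod: "(\<Prod>k\<in>UNIV. g i k (\<xi> k)) = \<phi> i (\<xi> i)" for i \<xi>
    unfolding g_def by simp
  have one: "integrable std_gaussian (\<lambda>\<xi>. \<phi> i (\<xi> i))" for i
    unfolding std_gaussian_def using std_normal_product.product_integrable_prod[of UNIV "g i"] gint
    by (simp add: gprod)
  have "(\<integral>\<xi>. \<phi> i (\<xi> i) \<partial>std_gaussian) = (\<Prod>k\<in>UNIV. \<integral>x. g i k x \<partial>std_normal_distribution)" for i
    unfolding std_gaussian_def using std_normal_product.product_integral_prod[of UNIV "g i"] gint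
    by (simp add: gprod)
  moreover have "(\<Prod>k\<in>UNIV. \<integral>x. g i k x \<partial>std_normal_distribution) = 0" for i
    by (intro prod_zero bexI[of _ i]) (auto simp: g_def mean)
  ultimately have "(\<integral>\<xi>. \<phi> i (\<xi> i) \<partial>std_gaussian) = 0" for i by simp
  then show "(\<integral>\<xi>. (\<Sum>i\<in>UNIV. \<phi> i (\<xi> i)) \<partial>std_gaussian) = 0"
    using one by simp
  show "integrable std_gaussian (\<lambda>\<xi>. \<Sum>i\<in>UNIV. \<phi> i (\<xi> i))"
    using one by simp
qed

subsection \<open>Exponential moments of quadratic forms with orthogonal rows\<close>

lemma std_gaussian_exp_diagonal:
  assumes "\<And>q. c q < 1"
  shows "(\<integral>\<^sup>+\<zeta>. exp ((\<Sum>q\<in>UNIV. c q * (\<zeta> q)\<^sup>2) / 2) \<partial>std_gaussian) = ennreal (\<Prod>q\<in>UNIV. 1 / sqrt (1 - c q))"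
proof -
  have "(\<integral>\<^sup>+\<zeta>. exp ((\<Sum>q\<in>UNIV. c q * (\<zeta> q)\<^sup>2) / 2) \<partial>std_gaussian) =
      (\<integral>\<^sup>+\<zeta>. (\<Prod>q\<in>UNIV. ennreal (exp (c q / 2 * (\<zeta> q)\<^sup>2))) \<partial>std_gaussian)"
    by (simp add: prod_ennreal exp_sum[symmetric] sum_divide_distrib)
  also have "\<dots> = (\<Prod>q\<in>UNIV. ennreal (1 / sqrt (1 - c q)))"
    using assms std_normal_exp_square[of "c _ / 2"]
    by (subst nn_integral_std_gaussian_prod) simp_all
  finally show ?thesis using assms by (simp add: prod_ennreal less_imp_le)
qed

lemma orthogonal_rows_square_sum:
  fixes B :: "'q::finite \<Rightarrow> 'p::finite \<Rightarrow> real"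
  assumes "\<And>q q'. (\<Sum>p\<in>UNIV. B q p * B q' p) = (if q = q' then c q else 0)"
  shows "(\<Sum>p\<in>UNIV. (\<Sum>q\<in>UNIV. \<zeta> q * B q p)\<^sup>2) = (\<Sum>q\<in>UNIV. c q * (\<zeta> q)\<^sup>2)"
proof -
  have "(\<Sum>p\<in>UNIV. (\<Sum>q\<in>UNIV. \<zeta> q * B q p)\<^sup>2)
      = (\<Sum>p\<in>UNIV. \<Sum>q\<in>UNIV. \<Sum>q'\<in>UNIV. \<zeta> q * \<zeta> q' * (B q p * B q' p))"
    by (simp add: power2_eq_square sum_product mult_ac)
  also have "\<dots> = (\<Sum>q\<in>UNIV. \<Sum>q'\<in>UNIV. \<Sum>p\<in>UNIV. \<zeta> q * \<zeta> q' * (B q p * B q' p))"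
    by (subst sum.swap) (simp add: sum.swap[of _ UNIV "UNIV :: 'p set"])
  also have "\<dots> = (\<Sum>q\<in>UNIV. c q * (\<zeta> q)\<^sup>2)"
    by (simp add: sum_distrib_left[symmetric] assms if_distrib power2_eq_square mult_ac cong: if_cong)
  finally show ?thesis .
qed

lemma bilinear_sum_swap:
  fixes B :: "'q::finite \<Rightarrow> 'p::finite \<Rightarrow> real"
  shows "(\<Sum>q\<in>UNIV. (\<Sum>p\<in>UNIV. B q p * \<omega> p) * \<zeta> q) = (\<Sum>p\<in>UNIV. (\<Sum>q\<in>UNIV. \<zeta> q * B q p) * \<omega> p)"
  unfolding sum_distrib_right by (subst sum.swap) (simp add: mult_ac)

text \<open>Linearizing the square by an auxiliary Gaussian vector and exchanging the two expectations
  replaces the rows by the columns, which decouples the coordinates.\<close>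

lemma std_gaussian_exp_quadratic:
  fixes B :: "'q::finite \<Rightarrow> 'p::finite \<Rightarrow> real"
  assumes B: "\<And>q q'. (\<Sum>p\<in>UNIV. B q p * B q' p) = (if q = q' then c q else 0)"
    and c: "\<And>q. c q < 1"
  shows "(\<integral>\<^sup>+\<omega>. exp ((\<Sum>q\<in>UNIV. (\<Sum>p\<in>UNIV. B q p * \<omega> p)\<^sup>2) / 2) \<partial>std_gaussian)
    = ennreal (\<Prod>q\<in>UNIV. 1 / sqrt (1 - c q))"
proof -
  interpret pair: pair_prob_space "std_gaussian :: ('p \<Rightarrow> real) measure" "std_gaussian :: ('q \<Rightarrow> real) measure"
    by standard
  have lin: "(\<integral>\<^sup>+\<xi>. exp (\<Sum>i\<in>UNIV. a i * \<xi> i) \<partial>std_gaussian) = ennreal (exp ((\<Sum>i\<in>UNIV. (a i)\<^sup>2) / 2))"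
    for a :: "'i::finite \<Rightarrow> real"
  proof -
    have "(\<integral>\<^sup>+\<xi>. exp (\<Sum>i\<in>UNIV. a i * \<xi> i) \<partial>std_gaussian) = (\<integral>\<^sup>+\<xi>. (\<Prod>i\<in>UNIV. ennreal (exp (a i * \<xi> i))) \<partial>std_gaussian)"
      by (simp add: prod_ennreal exp_sum)
    also have "\<dots> = (\<Prod>i\<in>UNIV. ennreal (exp ((a i)\<^sup>2 / 2)))"
      by (subst nn_integral_std_gaussian_prod) (simp_all add: std_normal_exp_linear)
    finally show ?thesis by (simp add: prod_ennreal exp_sum[symmetric] sum_divide_distrib)
  qed
  have "(\<integral>\<^sup>+\<omega>. exp ((\<Sum>q\<in>UNIV. (\<Sum>p\<in>UNIV. B q p * \<omega> p)\<^sup>2) / 2) \<partial>std_gaussian)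
      = (\<integral>\<^sup>+\<omega>. \<integral>\<^sup>+\<zeta>. exp (\<Sum>q\<in>UNIV. (\<Sum>p\<in>UNIV. B q p * \<omega> p) * \<zeta> q) \<partial>std_gaussian \<partial>std_gaussian)"
    by (simp only: lin)
  also have "\<dots> = (\<integral>\<^sup>+\<zeta>. \<integral>\<^sup>+\<omega>. exp (\<Sum>q\<in>UNIV. (\<Sum>p\<in>UNIV. B q p * \<omega> p) * \<zeta> q) \<partial>std_gaussian \<partial>std_gaussian)"
    by (rule pair.Fubini'[symmetric]) measurable
  also have "\<dots> = (\<integral>\<^sup>+\<zeta>. \<integral>\<^sup>+\<omega>. exp (\<Sum>p\<in>UNIV. (\<Sum>q\<in>UNIV. \<zeta> q * B q p) * \<omega> p) \<partial>std_gaussian \<partial>std_gaussian)"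
    by (simp only: bilinear_sum_swap)
  also have "\<dots> = (\<integral>\<^sup>+\<zeta>. exp ((\<Sum>q\<in>UNIV. c q * (\<zeta> q)\<^sup>2) / 2) \<partial>std_gaussian)"
    by (simp only: lin orthogonal_rows_square_sum[OF B])
  finally show ?thesis using std_gaussian_exp_diagonal[of c] c by simp
qed

text \<open>The same exchange of rows and columns with imaginary exponents: the Gaussian
  characteristic function produces the negative sign, and the integrand has modulus 1, so Fubini
  applies.\<close>

lemma std_gaussian_exp_neg_quadratic:
  fixes B :: "'q::finite \<Rightarrow> 'p::finite \<Rightarrow> real"
  assumes B: "\<And>q q'. (\<Sum>p\<in>UNIV. B q p * B q' p) = (if q = q' then c q else 0)"
  shows "(\<integral>\<^sup>+\<omega>. exp (- (\<Sum>q\<in>UNIV. (\<Sum>p\<in>UNIV. B q p * \<omega> p)\<^sup>2) / 2) \<partial>std_gaussian)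
    = ennreal (\<Prod>q\<in>UNIV. 1 / sqrt (1 + c q))"
proof -
  interpret pair: pair_prob_space "std_gaussian :: ('p \<Rightarrow> real) measure" "std_gaussian :: ('q \<Rightarrow> real) measure"
    by standard
  have lin: "(\<integral>\<xi>. exp (\<i> * (\<Sum>i\<in>UNIV. a i * \<xi> i)) \<partial>std_gaussian) = of_real (exp (- (\<Sum>i\<in>UNIV. (a i)\<^sup>2) / 2))"
    for a :: "'i::finite \<Rightarrow> real"
  proof -
    have int: "integrable std_normal_distribution (\<lambda>x. exp (\<i> * complex_of_real (a i * x)))" for i
      by (rule std_normal.integrable_const_bound[where B=1]) auto
    have "(\<integral>\<xi>. exp (\<i> * (\<Sum>i\<in>UNIV. a i * \<xi> i)) \<partial>std_gaussian) = (\<integral>\<xi>. (\<Prod>i\<in>UNIV. exp (\<i> * complex_of_real (a i * \<xi> i))) \<partial>std_gaussian)"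
      by (simp add: exp_sum[symmetric] sum_distrib_left)
    also have "\<dots> = (\<Prod>i\<in>UNIV. char std_normal_distribution (a i))"
      unfolding std_gaussian_def
      using std_normal_product.product_integral_prod[of UNIV "\<lambda>i x. exp (\<i> * complex_of_real (a i * x))"] int
      by (simp add: char_def)
    finally show ?thesis
      by (simp add: char_std_normal_distribution exp_sum[symmetric] sum_divide_distrib sum_negf flip: of_real_prod)
  qed
  let ?F = "\<lambda>\<omega> \<zeta>. exp (\<i> * complex_of_real (\<Sum>q\<in>UNIV. (\<Sum>p\<in>UNIV. B q p * \<omega> p) * \<zeta> q))"
  have int: "integrable (std_gaussian \<Otimes>\<^sub>M std_gaussian) (case_prod ?F)"
    by (rule pair.integrable_const_bound[where B=1]) auto
  have "complex_of_real (\<integral>\<omega>. exp (- (\<Sum>q\<in>UNIV. (\<Sum>p\<in>UNIV. B q p * \<omega> p)\<^sup>2) / 2) \<partial>std_gaussian)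
      = (\<integral>\<omega>. (\<integral>\<zeta>. ?F \<omega> \<zeta> \<partial>std_gaussian) \<partial>std_gaussian)"
    by (simp only: lin integral_complex_of_real[symmetric])
  also have "\<dots> = (\<integral>\<zeta>. (\<integral>\<omega>. ?F \<omega> \<zeta> \<partial>std_gaussian) \<partial>std_gaussian)"
    by (rule pair.Fubini_integral[OF int, symmetric])
  also have "\<dots> = (\<integral>\<zeta>. (\<integral>\<omega>. exp (\<i> * complex_of_real (\<Sum>p\<in>UNIV. (\<Sum>q\<in>UNIV. \<zeta> q * B q p) * \<omega> p)) \<partial>std_gaussian) \<partial>std_gaussian)"
    by (simp only: bilinear_sum_swap)
  also have "\<dots> = complex_of_real (\<integral>\<zeta>. exp (- (\<Sum>q\<in>UNIV. c q * (\<zeta> q)\<^sup>2) / 2) \<partial>std_gaussian)"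
    by (simp only: lin integral_complex_of_real[symmetric] orthogonal_rows_square_sum[OF B])
  finally have eq: "(\<integral>\<omega>. exp (- (\<Sum>q\<in>UNIV. (\<Sum>p\<in>UNIV. B q p * \<omega> p)\<^sup>2) / 2) \<partial>std_gaussian)
      = (\<integral>\<zeta>. exp (- (\<Sum>q\<in>UNIV. c q * (\<zeta> q)\<^sup>2) / 2) \<partial>std_gaussian)"
    by (simp only: of_real_eq_iff)
  have c0: "c q \<ge> 0" for q
    using B[of q q] sum_nonneg[of UNIV "\<lambda>p. B q p * B q p"] by simp
  have "integrable std_gaussian (\<lambda>\<omega>. exp (- (\<Sum>q\<in>UNIV. (\<Sum>p\<in>UNIV. B q p * \<omega> p)\<^sup>2) / 2))"
    by (rule std_gaussian.integrable_const_bound[where B=1]) (auto simp: sum_nonneg)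
  moreover have "integrable std_gaussian (\<lambda>\<zeta>. exp (- (\<Sum>q\<in>UNIV. c q * (\<zeta> q)\<^sup>2) / 2))"
    using c0 by (intro std_gaussian.integrable_const_bound[where B=1]) (auto simp: sum_nonneg)
  ultimately have "(\<integral>\<^sup>+\<omega>. exp (- (\<Sum>q\<in>UNIV. (\<Sum>p\<in>UNIV. B q p * \<omega> p)\<^sup>2) / 2) \<partial>std_gaussian)
      = (\<integral>\<^sup>+\<zeta>. exp (- (\<Sum>q\<in>UNIV. c q * (\<zeta> q)\<^sup>2) / 2) \<partial>std_gaussian)"
    using eq by (simp add: nn_integral_eq_integral)
  also have "\<dots> = (\<integral>\<^sup>+\<zeta>. exp ((\<Sum>q\<in>UNIV. (- c q) * (\<zeta> q)\<^sup>2) / 2) \<partial>std_gaussian)"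
    by (simp add: sum_negf)
  also have "\<dots> = ennreal (\<Prod>q\<in>UNIV. 1 / sqrt (1 - (- c q)))"
    using c0 by (intro std_gaussian_exp_diagonal) (smt (verit))
  finally show ?thesis by simp
qed

subsection \<open>Gaussian matrices\<close>

lemma sum_UNIV_prod: "(\<Sum>p\<in>UNIV. g p) = (\<Sum>a\<in>UNIV. \<Sum>b\<in>UNIV. g (a, b))"
  by (simp add: sum.cartesian_product)

lemma measurable_matrix_of_entries [measurable]:
  "(\<lambda>f. (\<chi> i j. f (i, j)) :: real^'s^'d) \<in> borel_measurable std_gaussian"
proof (subst borel_measurable_euclidean_space, intro ballI)
  fix b :: "real^'s^'d" assume "b \<in> Basis"
  then obtain i j where "b = axis i (axis j 1)" by (auto simp: Basis_vec_def)
  then have "(\<lambda>f. ((\<chi> i j. f (i, j)) :: real^'s^'d) \<bullet> b) = (\<lambda>f. f (i, j))"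
    by (simp add: inner_axis)
  then show "(\<lambda>f. ((\<chi> i j. f (i, j)) :: real^'s^'d) \<bullet> b) \<in> borel_measurable std_gaussian"
    by simp
qed

lemma gaussian_matrix_eq: "gaussian_matrix = distr std_gaussian borel (\<lambda>f. \<chi> i j. f (i, j))"
  by (simp add: gaussian_matrix_def std_gaussian_def)

lemma sets_gaussian_matrix [measurable_cong, simp]: "sets gaussian_matrix = sets borel"
  by (simp add: gaussian_matrix_def)

lemma space_gaussian_matrix [simp]: "space gaussian_matrix = UNIV"
  by (simp add: gaussian_matrix_def)

interpretation gaussian_matrix: prob_space gaussian_matrix
  unfolding gaussian_matrix_eq by (rule std_gaussian.prob_space_distr) measurable

lemma nn_integral_gaussian_matrix:
  assumes [measurable]: "f \<in> borel_measurable borel"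
  shows "(\<integral>\<^sup>+\<Omega>. f \<Omega> \<partial>gaussian_matrix) = (\<integral>\<^sup>+g. f (\<chi> i j. g (i, j)) \<partial>std_gaussian)"
  unfolding gaussian_matrix_eq by (rule nn_integral_distr) measurable

lemma borel_measurable_matrix_entry [measurable]:
  "(\<lambda>\<Omega> :: real^'s^'d. \<Omega> $ i $ j) \<in> borel_measurable borel"
  by (intro borel_measurable_continuous_onI continuous_intros)

text \<open>The entries of \<open>transpose \<Omega> *v y\<close> are independent centered normals
  of variance \<open>y \<bullet> y\<close>, one for each column of \<open>\<Omega>\<close>.\<close>

lemma gaussian_matrix_exp_neg_square:
  fixes y :: "real^'d"
  assumes "b \<ge> 0"
  shows "(\<integral>\<^sup>+\<Omega>. exp (- b * (\<Sum>i\<in>UNIV. (\<Sum>k\<in>UNIV. \<Omega> $ k $ i * y $ k)\<^sup>2)) \<partial>(gaussian_matrix :: (real^'s^'d) measure))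
    = ennreal ((1 / sqrt (1 + 2 * b * (y \<bullet> y))) ^ CARD('s))"
proof -
  \<comment> \<open>Row \<open>i\<close> reads only column \<open>i\<close> of the sketch, so
    distinct rows have disjoint supports and are orthogonal.\<close>
  define B where "B i p = (if snd p = i then sqrt (2 * b) * y $ (fst p) else 0)" for i :: 's and p :: "'d \<times> 's"
  have BB: "(\<Sum>p\<in>UNIV. B i p * B j p) = (if i = j then 2 * b * (y \<bullet> y) else 0)" for i j
  proof -
    have "(\<Sum>p\<in>UNIV. B i p * B j p) = (\<Sum>k\<in>UNIV. \<Sum>q\<in>UNIV. if q = i then if q = j then 2 * b * (y $ k * y $ k) else 0 else 0)"
      using assms unfolding sum_UNIV_prod B_def by (intro sum.cong refl) auto
    then show ?thesis by (simp add: inner_vec_def sum_distrib_left)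
  qed
  have Bf: "(\<Sum>p\<in>UNIV. B i p * f p) = sqrt (2 * b) * (\<Sum>k\<in>UNIV. f (k, i) * y $ k)" for i f
    unfolding sum_distrib_left
    by (simp add: sum_UNIV_prod B_def if_distrib[of "\<lambda>x. x * _"] cong: if_cong) (simp add: mult_ac)
  have "(\<integral>\<^sup>+\<Omega>. exp (- b * (\<Sum>i\<in>UNIV. (\<Sum>k\<in>UNIV. \<Omega> $ k $ i * y $ k)\<^sup>2)) \<partial>(gaussian_matrix :: (real^'s^'d) measure))
      = (\<integral>\<^sup>+f. exp (- (\<Sum>i\<in>UNIV. (\<Sum>p\<in>UNIV. B i p * f p)\<^sup>2) / 2) \<partial>std_gaussian)"
    using assms by (subst nn_integral_gaussian_matrix)
      (simp_all add: Bf power_mult_distrib sum_distrib_left[symmetric])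
  also have "\<dots> = ennreal (\<Prod>i\<in>(UNIV::'s set). 1 / sqrt (1 + 2 * b * (y \<bullet> y)))"
    by (rule std_gaussian_exp_neg_quadratic) (rule BB)
  finally show ?thesis by simp
qed

lemma inverse_sqrt_le_exp:
  fixes u :: real
  assumes "0 \<le> u" "u \<le> 1/2"
  shows "1 / sqrt (1 - u) \<le> exp (u / 2 + u\<^sup>2)"
proof -
  have "- u - 2 * u\<^sup>2 \<le> ln (1 - u)"
    using assms by (rule ln_one_minus_pos_lower_bound)
  then have "exp (- u - 2 * u\<^sup>2) \<le> 1 - u"
    using assms by (subst (asm) ln_ge_iff) auto
  then have "sqrt (exp (- u - 2 * u\<^sup>2)) \<le> sqrt (1 - u)" by simp
  moreover have "sqrt (exp (- u - 2 * u\<^sup>2)) = exp (- (u / 2 + u\<^sup>2))"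
    by (rule real_sqrt_unique) (simp_all add: exp_double[symmetric])
  ultimately have "1 / sqrt (1 - u) \<le> 1 / exp (- (u / 2 + u\<^sup>2))"
    by (intro divide_left_mono) (use assms in auto)
  then show ?thesis by (simp add: exp_minus field_simps)
qed

text \<open>One row of \<open>B\<close> per pair of a sketch column and a basis vector;
  orthonormality of \<open>e\<close> makes these rows orthogonal. The bound serves as the moment
  generating function in a Chernoff estimate.\<close>

lemma gaussian_matrix_exp_weighted_square:
  fixes e :: "'d \<Rightarrow> real^'d" and k :: "'d \<Rightarrow> real"
  assumes e: "orthonormal_family e" and k: "\<And>j. 0 \<le> k j" "\<And>j. k j \<le> 1" and \<mu>: "0 \<le> \<mu>" "\<mu> \<le> 1/4"
  shows "(\<integral>\<^sup>+\<Omega>. exp (\<mu> * (\<Sum>i\<in>UNIV. \<Sum>j\<in>UNIV. k j * (\<Sum>m\<in>UNIV. \<Omega> $ m $ i * e j $ m)\<^sup>2)) \<partial>(gaussian_matrix :: (real^'s^'d) measure))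
    \<le> ennreal (exp (real CARD('s) * (\<mu> + 4 * \<mu>\<^sup>2) * (\<Sum>j\<in>UNIV. k j)))"
proof -
  define B where "B q p = (if snd p = fst q then sqrt (2 * \<mu> * k (snd q)) * e (snd q) $ (fst p) else 0)"
    for q :: "'s \<times> 'd" and p :: "'d \<times> 's"
  have BB: "(\<Sum>p\<in>UNIV. B q p * B q' p) = (if q = q' then 2 * \<mu> * k (snd q) else 0)" for q q'
  proof -
    have "(\<Sum>p\<in>UNIV. B q p * B q' p) = (\<Sum>m\<in>UNIV. \<Sum>i\<in>UNIV. if i = fst q then
        if i = fst q' then sqrt (2 * \<mu> * k (snd q)) * sqrt (2 * \<mu> * k (snd q')) * (e (snd q) $ m * e (snd q') $ m) else 0 else 0)"
      unfolding sum_UNIV_prod B_def by (intro sum.cong refl) auto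
    also have "\<dots> = (if fst q = fst q' then sqrt (2 * \<mu> * k (snd q)) * sqrt (2 * \<mu> * k (snd q')) * (e (snd q) \<bullet> e (snd q')) else 0)"
      by (simp add: inner_vec_def sum_distrib_left)
    finally show ?thesis
      using e k \<mu> by (auto simp: orthonormal_family_def prod_eq_iff)
  qed
  have Bf: "(\<Sum>p\<in>UNIV. B (i, j) p * f p) = sqrt (2 * \<mu> * k j) * (\<Sum>m\<in>UNIV. f (m, i) * e j $ m)" for i j f
    unfolding sum_distrib_left
    by (simp add: sum_UNIV_prod B_def if_distrib[of "\<lambda>x. x * _"] cong: if_cong) (simp add: mult_ac)
  have Bf2: "(\<Sum>q\<in>UNIV. (\<Sum>p\<in>UNIV. B q p * f p)\<^sup>2)
      = 2 * (\<mu> * (\<Sum>i\<in>UNIV. \<Sum>j\<in>UNIV. k j * (\<Sum>m\<in>UNIV. f (m, i) * e j $ m)\<^sup>2))" for f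
    unfolding sum_UNIV_prod[of "\<lambda>q. (\<Sum>p\<in>UNIV. B q p * f p)\<^sup>2"] Bf power_mult_distrib
    using k \<mu> by (simp add: sum_distrib_left mult_ac)
  have small: "2 * \<mu> * k j \<le> 1/2" for j
    using k[of j] \<mu> mult_mono[of \<mu> "1/4" "k j" 1] by simp
  have "(\<integral>\<^sup>+\<Omega>. exp (\<mu> * (\<Sum>i\<in>UNIV. \<Sum>j\<in>UNIV. k j * (\<Sum>m\<in>UNIV. \<Omega> $ m $ i * e j $ m)\<^sup>2)) \<partial>(gaussian_matrix :: (real^'s^'d) measure))
      = (\<integral>\<^sup>+f. exp ((\<Sum>q\<in>UNIV. (\<Sum>p\<in>UNIV. B q p * f p)\<^sup>2) / 2) \<partial>std_gaussian)"
    by (subst nn_integral_gaussian_matrix) (simp_all add: Bf2)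
  also have "\<dots> = ennreal (\<Prod>q\<in>(UNIV :: ('s \<times> 'd) set). 1 / sqrt (1 - 2 * \<mu> * k (snd q)))"
    by (rule std_gaussian_exp_quadratic) (use BB small in \<open>auto intro: le_less_trans[of _ "1/2"]\<close>)
  also have "\<dots> \<le> ennreal (\<Prod>q\<in>(UNIV :: ('s \<times> 'd) set). exp (\<mu> * k (snd q) + 4 * \<mu>\<^sup>2 * k (snd q)))"
  proof (intro ennreal_leI prod_mono conjI)
    fix q :: "'s \<times> 'd"
    let ?k = "k (snd q)"
    show "0 \<le> 1 / sqrt (1 - 2 * \<mu> * ?k)" using small[of "snd q"] by simp
    have "1 / sqrt (1 - 2 * \<mu> * ?k) \<le> exp (2 * \<mu> * ?k / 2 + (2 * \<mu> * ?k)\<^sup>2)"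
      using k \<mu> small by (intro inverse_sqrt_le_exp) auto
    \<comment> \<open>Since weights lie in the unit interval, \<open>?k\<^sup>2 \<le> ?k\<close>,
      and the second-order term is again controlled by the trace.\<close>
    also have "\<dots> \<le> exp (\<mu> * ?k + 4 * \<mu>\<^sup>2 * ?k)"
      using k[of "snd q"] by (auto simp: power_mult_distrib power2_eq_square[of ?k] intro!: mult_left_mono mult_left_le)
    finally show "1 / sqrt (1 - 2 * \<mu> * ?k) \<le> exp (\<mu> * ?k + 4 * \<mu>\<^sup>2 * ?k)" .
  qed
  also have "(\<Prod>q\<in>(UNIV :: ('s \<times> 'd) set). exp (\<mu> * k (snd q) + 4 * \<mu>\<^sup>2 * k (snd q)))
      = exp (\<Sum>i\<in>(UNIV :: 's set). \<Sum>j\<in>UNIV. (\<mu> + 4 * \<mu>\<^sup>2) * k j)"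
    by (simp add: exp_sum[symmetric] sum_UNIV_prod distrib_right)
  also have "\<dots> = exp (real CARD('s) * (\<mu> + 4 * \<mu>\<^sup>2) * (\<Sum>j\<in>UNIV. k j))"
    by (simp add: sum_distrib_left[symmetric] mult.assoc)
  finally show ?thesis .
qed

subsection \<open>Gaussian smoothing\<close>

text \<open>Jensen's inequality from the tangent line of \<open>exp\<close> at the mean; if
  \<open>exp\<close> of \<open>g\<close> is not integrable, the right side is infinite.\<close>

lemma (in prob_space) exp_expectation_le:
  assumes g: "integrable M g"
  shows "ennreal (exp (expectation g)) \<le> (\<integral>\<^sup>+x. exp (g x) \<partial>M)"
proof (cases "integrable M (\<lambda>x. exp (g x))")
  case True
  let ?c = "expectation g"
  have "exp ?c = expectation (\<lambda>x. exp ?c * (1 + (g x - ?c)))"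
    using g by (simp add: prob_space)
  also have "\<dots> \<le> expectation (\<lambda>x. exp (g x))"
  proof (rule integral_mono[OF _ True])
    show "integrable M (\<lambda>x. exp ?c * (1 + (g x - ?c)))" using g by simp
    fix x
    have "exp ?c * (1 + (g x - ?c)) \<le> exp ?c * exp (g x - ?c)"
      by (intro mult_left_mono exp_ge_add_one_self) auto
    then show "exp ?c * (1 + (g x - ?c)) \<le> exp (g x)" by (simp add: exp_diff)
  qed
  finally show ?thesis
    using True by (simp add: nn_integral_eq_integral ennreal_leI)
next
  case False
  have "(\<lambda>x. exp (g x)) \<in> borel_measurable M" using g by simp
  then have "(\<integral>\<^sup>+x. exp (g x) \<partial>M) = \<infinity>"
    using False by (simp add: integrable_iff_bounded less_top[symmetric])
  then show ?thesis by simp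
qed

section \<open>Means and variances of linear and quadratic Gaussian sums\<close>

lemma std_normal_moments:
  "integrable std_normal_distribution (\<lambda>x. x)" "integrable std_normal_distribution (\<lambda>x. x\<^sup>2)"
  "integrable std_normal_distribution (\<lambda>x. x ^ 3)" "integrable std_normal_distribution (\<lambda>x. x ^ 4)"
  "(\<integral>x. x \<partial>std_normal_distribution) = 0" "(\<integral>x. x\<^sup>2 \<partial>std_normal_distribution) = 1"
  "(\<integral>x. x ^ 3 \<partial>std_normal_distribution) = 0" "(\<integral>x. x ^ 4 \<partial>std_normal_distribution) = 3"
  using integrable_std_normal_distribution_moment[of 1] integrable_std_normal_distribution_moment[of 2]
    integrable_std_normal_distribution_moment[of 3] integrable_std_normal_distribution_moment[of 4]
    integral_std_normal_distribution_moment_odd[of 1] integral_std_normal_distribution_moment_odd[of 3]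
    std_normal_distribution_even_moments(1)[of 1] std_normal_distribution_even_moments(1)[of 2]
  by (simp_all add: fact_numeral)

lemma std_normal_centered_quadratic:
  defines "\<phi> a b x \<equiv> a * x + b * (x\<^sup>2 - 1)"
  shows "integrable std_normal_distribution (\<phi> a b)"
    "integrable std_normal_distribution (\<lambda>x. (\<phi> a b x)\<^sup>2)"
    "(\<integral>x. \<phi> a b x \<partial>std_normal_distribution) = 0"
    "(\<integral>x. (\<phi> a b x)\<^sup>2 \<partial>std_normal_distribution) = a\<^sup>2 + 2 * b\<^sup>2"
proof -
  note [simp] = std_normal_moments std_normal.prob_space[simplified]
  have sq: "(\<phi> a b x)\<^sup>2 = a\<^sup>2 * x\<^sup>2 + 2 * a * b * x ^ 3 - 2 * a * b * x + b\<^sup>2 * x ^ 4 - 2 * b\<^sup>2 * x\<^sup>2 + b\<^sup>2" for x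
    unfolding \<phi>_def by (simp add: power2_eq_square power3_eq_cube power4_eq_xxxx algebra_simps)
  show "integrable std_normal_distribution (\<phi> a b)"
    unfolding \<phi>_def by simp
  show "integrable std_normal_distribution (\<lambda>x. (\<phi> a b x)\<^sup>2)"
    unfolding sq by simp
  show "(\<integral>x. \<phi> a b x \<partial>std_normal_distribution) = 0"
    unfolding \<phi>_def by simp
  show "(\<integral>x. (\<phi> a b x)\<^sup>2 \<partial>std_normal_distribution) = a\<^sup>2 + 2 * b\<^sup>2"
    unfolding sq by simp
qed

lemma std_gaussian_linear:
  fixes a :: "'i::finite \<Rightarrow> real"
  shows "integrable std_gaussian (\<lambda>\<xi>. (\<Sum>i\<in>UNIV. a i * \<xi> i)\<^sup>2)"
    "(\<integral>\<xi>. (\<Sum>i\<in>UNIV. a i * \<xi> i)\<^sup>2 \<partial>std_gaussian) = (\<Sum>i\<in>UNIV. (a i)\<^sup>2)"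
    "integrable std_gaussian (\<lambda>\<xi>. \<Sum>i\<in>UNIV. a i * \<xi> i)"
    "(\<integral>\<xi>. (\<Sum>i\<in>UNIV. a i * \<xi> i) \<partial>std_gaussian) = 0"
  using std_gaussian_centered_sum_square[of "\<lambda>i x. a i * x + 0 * (x\<^sup>2 - 1)"]
    std_normal_centered_quadratic[of _ 0] by simp_all

text \<open>The Gibbs variational bound for a translated Gaussian: the subtracted half squared norm
  of \<open>h\<close> is its relative entropy to the standard one. Translation brings in a linear
  term of mean zero, and Jensen's inequality moves the expectation into the exponent.\<close>

lemma gaussian_smoothing_lower_bound:
  fixes h :: "'i::finite \<Rightarrow> real"
  assumes [measurable]: "F \<in> borel_measurable std_gaussian"
    and int: "integrable std_gaussian (\<lambda>\<xi>. F (\<lambda>i. \<xi> i + h i))"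
  shows "ennreal (exp ((\<integral>\<xi>. F (\<lambda>i. \<xi> i + h i) \<partial>std_gaussian) - (\<Sum>i\<in>UNIV. (h i)\<^sup>2) / 2))
    \<le> (\<integral>\<^sup>+\<xi>. exp (F \<xi>) \<partial>std_gaussian)"
proof -
  let ?g = "\<lambda>\<xi>. - (\<Sum>i\<in>UNIV. h i * \<xi> i) - (\<Sum>i\<in>UNIV. (h i)\<^sup>2) / 2 + F (\<lambda>i. \<xi> i + h i)"
  note lin = std_gaussian_linear(3,4)[of h]
  have "(\<integral>\<xi>. ?g \<xi> \<partial>std_gaussian) = (\<integral>\<xi>. F (\<lambda>i. \<xi> i + h i) \<partial>std_gaussian) - (\<Sum>i\<in>UNIV. (h i)\<^sup>2) / 2"
    using int lin by (simp add: std_gaussian.prob_space[simplified] del: Bochner_Integration.integral_sum)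
  moreover have "integrable std_gaussian ?g"
    using int lin by simp
  ultimately have "ennreal (exp ((\<integral>\<xi>. F (\<lambda>i. \<xi> i + h i) \<partial>std_gaussian) - (\<Sum>i\<in>UNIV. (h i)\<^sup>2) / 2))
      \<le> (\<integral>\<^sup>+\<xi>. exp (?g \<xi>) \<partial>std_gaussian)"
    using std_gaussian.exp_expectation_le[of ?g] by simp
  also have "\<dots> = (\<integral>\<^sup>+\<xi>. exp (F \<xi>) \<partial>std_gaussian)"
    by (subst (2) cameron_martin[of _ h]) (simp_all add: exp_add ennreal_mult')
  finally show ?thesis .
qed

subsection \<open>Numerical estimates\<close>

text \<open>Quadratic bounds on \<open>exp\<close> are sharp enough only at small arguments, hence
  the powers 20 and 4.\<close>

lemma ln_3_bounds: "53/50 \<le> ln (3::real)" "ln (3::real) \<le> 10/9"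
proof -
  have "exp (0.053::real) \<le> 1 + 0.053 + 0.053\<^sup>2"
    by (rule exp_bound) auto
  then have "exp (0.053::real) ^ 20 \<le> (1 + 0.053 + 0.053\<^sup>2) ^ 20"
    by (rule power_mono) simp
  also have "\<dots> \<le> 3" by (simp add: power_divide eval_nat_numeral)
  also have "exp (0.053::real) ^ 20 = exp 1.06"
    by (simp flip: exp_of_nat_mult)
  finally show "53/50 \<le> ln (3::real)" using ln_ge_iff[of 3 "53/50"] by simp
  have "1 + 5/18 + (5/18)\<^sup>2 / 2 \<le> exp (5/18::real)"
    by (rule exp_lower_Taylor_quadratic) simp
  then have "(1 + 5/18 + (5/18)\<^sup>2 / 2) ^ 4 \<le> exp (5/18::real) ^ 4"
    by (rule power_mono) simp
  also have "exp (5/18::real) ^ 4 = exp (10/9)"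
    by (simp flip: exp_of_nat_mult)
  also have "(3::real) \<le> (1 + 5/18 + (5/18)\<^sup>2 / 2) ^ 4"
    by (simp add: power_divide)
  finally have "3 \<le> exp (10/9::real)" by simp
  then show "ln (3::real) \<le> 10/9" by (metis exp_gt_zero ln_exp ln_le_cancel_iff zero_less_numeral)
qed

text \<open>The difference has derivative \<open>w * (1 + 2 * w) / (1 + w)\<close>, with sign
  changes at -1/2 and 0. Its minimum is therefore at 0, where it vanishes, or at the left end, where
  it equals \<open>10/9 - ln 3\<close>.\<close>

lemma ln_ge_quadratic:
  fixes w :: real
  assumes "-2/3 \<le> w"
  shows "w - w\<^sup>2 \<le> ln (1 + w)"
proof -
  define g where "g w = ln (1 + w) - w + w\<^sup>2" for w :: real
  have deriv: "(g has_real_derivative (w * (1 + 2 * w) / (1 + w))) (at w)" if "w > -1" for w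
    unfolding g_def using that
    by (auto intro!: derivative_eq_intros simp: field_simps power2_eq_square)
  have "g w \<ge> 0"
  proof -
    consider "w \<ge> 0" | "-1/2 \<le> w" "w \<le> 0" | "w \<le> -1/2" by linarith
    then show ?thesis
    proof cases
      case 1
      have "g 0 \<le> g w"
        using 1 by (intro DERIV_nonneg_imp_nondecreasing[of 0 w g]) (auto intro!: exI deriv)
      then show ?thesis by (simp add: g_def)
    next
      case 2
      have "g 0 \<le> g w"
      proof (intro DERIV_nonpos_imp_nonincreasing[of w 0 g] exI conjI)
        fix x assume x: "w \<le> x" "x \<le> 0"
        show "(g has_real_derivative (x * (1 + 2 * x) / (1 + x))) (at x)" using x 2 by (intro deriv) auto
        show "x * (1 + 2 * x) / (1 + x) \<le> 0"
          using x 2 by (intro divide_nonpos_pos mult_nonpos_nonneg) auto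
      qed (use 2 in auto)
      then show ?thesis by (simp add: g_def)
    next
      case 3
      have "g (-2/3) \<le> g w"
      proof (intro DERIV_nonneg_imp_nondecreasing[of "-2/3" w g] exI conjI)
        fix x assume x: "-2/3 \<le> x" "x \<le> w"
        show "(g has_real_derivative (x * (1 + 2 * x) / (1 + x))) (at x)" using x 3 by (intro deriv) auto
        show "x * (1 + 2 * x) / (1 + x) \<ge> 0"
          using x 3 by (intro divide_nonneg_pos mult_nonpos_nonpos) auto
      qed (use assms in auto)
      moreover have "g (-2/3) \<ge> 0"
        using ln_3_bounds(2) by (simp add: g_def ln_div power2_eq_square)
      ultimately show ?thesis by simp
    qed
  qed
  then show ?thesis by (simp add: g_def)
qed

text \<open>The expansion of \<open>ln (1 + 4/3 * Y) / 2\<close> to second order around \<open>Y = 3/2\<close>, with the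
  quadratic coefficient doubled so that it is a lower bound for all \<open>Y \<ge> 0\<close>. The expansion point is
  the mean of the smoothed squared norm when the effective dimension is an eighth of the sketch size.\<close>

definition log_quad :: "real \<Rightarrow> real" where
  "log_quad W = (ln 3 + 4/9 * W - 16/81 * W\<^sup>2) / 2"

lemma log_quad_le:
  assumes "Y \<ge> 0"
  shows "log_quad (Y - 3/2) \<le> ln (1 + 4/3 * Y) / 2"
proof -
  \<comment> \<open>Relative deviation of \<open>1 + 4/3 * Y\<close> from its value 3 at the
    expansion point; \<open>Y = 0\<close> corresponds to the left end -2/3 of
    \<open>ln_ge_quadratic\<close>.\<close>
  define w where "w = 4/9 * (Y - 3/2)"
  have "w - w\<^sup>2 \<le> ln (1 + w)" using assms by (intro ln_ge_quadratic) (simp add: w_def)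
  moreover have "1 + 4/3 * Y = 3 * (1 + w)" by (simp add: w_def field_simps)
  then have "ln (1 + 4/3 * Y) = ln (3 * (1 + w))" by (rule arg_cong)
  moreover have "ln (3 * (1 + w)) = ln 3 + ln (1 + w)"
    using assms by (intro ln_mult_pos) (simp_all add: w_def field_simps)
  moreover have "log_quad (Y - 3/2) = (ln 3 + (w - w\<^sup>2)) / 2"
    by (simp add: log_quad_def w_def power2_eq_square field_simps)
  ultimately show ?thesis by simp
qed

lemma exp_log_quad_le:
  assumes "Y \<ge> 0"
  shows "exp (real n * log_quad (Y - 3/2)) * (1 / sqrt (1 + 4/3 * Y)) ^ n \<le> 1"
proof -
  have "exp (log_quad (Y - 3/2)) \<le> exp (ln (1 + 4/3 * Y) / 2)"
    using log_quad_le[OF assms] by simp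
  also have "\<dots> = sqrt (1 + 4/3 * Y)"
    using assms by (intro real_sqrt_unique[symmetric]) (auto simp: exp_double[symmetric])
  finally have "exp (log_quad (Y - 3/2)) * (1 / sqrt (1 + 4/3 * Y)) \<le> 1"
    using assms by simp
  then have "(exp (log_quad (Y - 3/2)) * (1 / sqrt (1 + 4/3 * Y))) ^ n \<le> 1"
    using assms by (intro power_le_one) auto
  then show ?thesis by (simp only: power_mult_distrib exp_of_nat_mult)
qed

text \<open>The exponent of the kernel-vector lower bound at precision \<open>n / 4\<close>:
  \<open>V\<close> bounds a variance, \<open>T\<close> is the column energy and \<open>X\<close> the
  squared norm of the shift. After division by \<open>n\<close> everything depends on
  \<open>r = 4 * D / n\<close> alone, up to numerical constants.\<close>

lemma smoothing_bound_exceeds_budget: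
  fixes n D L V T X :: real
  assumes n: "8 * D + 64 * L \<le> n" "n \<ge> 170" and D: "D \<ge> 0" and L: "L \<ge> 0"
    and V: "V \<le> 16 / n + 32 * D / n\<^sup>2" and T: "T \<le> n * D + n\<^sup>2 / 72" and X: "X \<le> 55/48"
    and w: "w = 4 * D / n - 1/2"
  shows "L < n * ((ln 3 + 4/9 * w - 16/81 * (w\<^sup>2 + V)) / 2) - 8/3 * T / n - n * X / 8"
proof -
  define r where "r = 4 * D / n"
  have np: "n > 0" using n by simp
  have r: "0 \<le> r" "r \<le> 1/2" and Dr: "D = r * n / 4"
    using n D L np by (auto simp: r_def field_simps)
  have wr: "w = r - 1/2" by (simp add: w r_def)
  have L': "L \<le> n * ((1 - 2 * r) / 64)" using n(1) by (simp add: Dr field_simps)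
  have "V \<le> (16 + 8 * r) / n" using V np by (simp add: Dr field_simps power2_eq_square)
  also have "\<dots> \<le> 20 / n" using r np by (intro divide_right_mono) auto
  also have "\<dots> \<le> 20 / 170" using n by (intro divide_left_mono) auto
  finally have V': "V \<le> 2 / 17" by simp
  have "8/3 * T / n \<le> 8/3 * (n * D + n\<^sup>2 / 72) / n"
    using T np by (intro divide_right_mono mult_left_mono) auto
  also have "\<dots> = n * (2/3 * r + 1/27)"
    using np by (simp add: Dr field_simps power2_eq_square)
  finally have T': "8/3 * T / n \<le> n * (2/3 * r + 1/27)" .
  have X': "n * X / 8 \<le> n * (55/384)" using X np by simp
  \<comment> \<open>Replacing the square by a linear bound leaves an inequality that is linear in
    \<open>r\<close> and \<open>ln 3\<close>.\<close>
  have "r * r \<le> r * (1/2)" using r by (intro mult_left_mono) auto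
  then have "w\<^sup>2 \<le> 1/4 - r/2"
    by (simp add: wr power2_eq_square algebra_simps)
  then have "(1 - 2 * r) / 64 + (2/3 * r + 1/27) + 55/384 < (ln 3 + 4/9 * w - 16/81 * (w\<^sup>2 + V)) / 2"
    using V' r ln_3_bounds(1) unfolding wr by argo
  then have "n * ((1 - 2 * r) / 64 + (2/3 * r + 1/27) + 55/384) < n * ((ln 3 + 4/9 * w - 16/81 * (w\<^sup>2 + V)) / 2)"
    using np by (rule mult_strict_left_mono)
  then show ?thesis using L' T' X' by (simp only: distrib_left)
qed

subsection \<open>The smoothed partition function\<close>

definition proj_col :: "('d::finite \<Rightarrow> real^'d) \<Rightarrow> real^'s^'d \<Rightarrow> 'd \<Rightarrow> 's \<Rightarrow> real" where
  "proj_col e \<Omega> j i = (\<Sum>m\<in>UNIV. \<Omega> $ m $ i * e j $ m)"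

text \<open>This is the trace of \<open>transpose \<Omega> ** K ** \<Omega>\<close>, where
  \<open>K\<close> has eigenvalues \<open>k j\<close> with eigenvectors \<open>e j\<close>.\<close>

definition weighted_energy :: "('d::finite \<Rightarrow> real^'d) \<Rightarrow> ('d \<Rightarrow> real) \<Rightarrow> real^'s^'d \<Rightarrow> real" where
  "weighted_energy e k \<Omega> = (\<Sum>i\<in>UNIV. \<Sum>j\<in>UNIV. k j * (proj_col e \<Omega> j i)\<^sup>2)"

text \<open>With \<open>y = (\<Sum>j\<in>UNIV. (sqrt (k j / \<beta>) * \<xi> j) *\<^sub>R e
  j)\<close>, the first sum is the squared norm of \<open>transpose \<Omega> *v y\<close> and the
  sum inside \<open>log_quad\<close> is that of \<open>y\<close>. Thus \<open>\<beta>\<close> is the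
  precision of the smoothing Gaussian.\<close>

definition smoothed_exponent :: "('d::finite \<Rightarrow> real^'d) \<Rightarrow> ('d \<Rightarrow> real) \<Rightarrow> real \<Rightarrow> real^'s^'d \<Rightarrow> ('d \<Rightarrow> real) \<Rightarrow> real" where
  "smoothed_exponent e k \<beta> \<Omega> \<xi> =
     - (2/3) * (\<Sum>i\<in>UNIV. (\<Sum>j\<in>UNIV. sqrt (k j / \<beta>) * proj_col e \<Omega> j i * \<xi> j)\<^sup>2)
     + real CARD('s) * log_quad ((\<Sum>j\<in>UNIV. k j / \<beta> * (\<xi> j)\<^sup>2) - 3/2)"

definition partition_function :: "('d::finite \<Rightarrow> real^'d) \<Rightarrow> ('d \<Rightarrow> real) \<Rightarrow> real \<Rightarrow> real^'s^'d \<Rightarrow> ennreal" where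
  "partition_function e k \<beta> \<Omega> = (\<integral>\<^sup>+\<xi>. exp (smoothed_exponent e k \<beta> \<Omega> \<xi>) \<partial>std_gaussian)"

lemma borel_measurable_proj_col [measurable]: "(\<lambda>\<Omega>. proj_col e \<Omega> j i) \<in> borel_measurable borel"
  unfolding proj_col_def by measurable

lemma borel_measurable_weighted_energy [measurable]: "weighted_energy e k \<in> borel_measurable borel"
  unfolding weighted_energy_def by measurable

lemma borel_measurable_smoothed_exponent [measurable]:
  "case_prod (smoothed_exponent e k \<beta>) \<in> borel_measurable (borel \<Otimes>\<^sub>M std_gaussian)"
  unfolding smoothed_exponent_def log_quad_def by measurable

lemma borel_measurable_partition_function [measurable]: "partition_function e k \<beta> \<in> borel_measurable borel"
  unfolding partition_function_def
  by (rule std_gaussian.borel_measurable_nn_integral) measurable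

context
  fixes e :: "'d::finite \<Rightarrow> real^'d" and k :: "'d \<Rightarrow> real" and \<beta> :: real
  assumes e: "orthonormal_family e" and k0: "\<And>j. 0 \<le> k j" and k1: "\<And>j. k j \<le> 1" and \<beta>: "\<beta> > 0"
begin

text \<open>After exchanging the integrals the sketch is averaged for fixed \<open>\<xi>\<close>,
  where \<open>log_quad\<close> undercompensates the exact Gaussian factor with
  \<open>4/3 = 2 * (2/3)\<close>.\<close>

lemma expectation_partition_function:
  "(\<integral>\<^sup>+\<Omega>. partition_function e k \<beta> \<Omega> \<partial>(gaussian_matrix :: (real^'s^'d) measure)) \<le> 1"
proof -
  interpret pair: pair_prob_space "gaussian_matrix :: (real^'s^'d) measure" "std_gaussian :: ('d \<Rightarrow> real) measure"
    by standard
  have "(\<integral>\<^sup>+\<Omega>. partition_function e k \<beta> \<Omega> \<partial>(gaussian_matrix :: (real^'s^'d) measure))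
      = (\<integral>\<^sup>+\<xi>. \<integral>\<^sup>+\<Omega>. exp (smoothed_exponent e k \<beta> \<Omega> \<xi>) \<partial>(gaussian_matrix :: (real^'s^'d) measure) \<partial>std_gaussian)"
    unfolding partition_function_def by (rule pair.Fubini'[symmetric]) measurable
  also have "\<dots> \<le> (\<integral>\<^sup>+\<xi>. 1 \<partial>(std_gaussian :: ('d \<Rightarrow> real) measure))"
  proof (rule nn_integral_mono)
    fix \<xi> :: "'d \<Rightarrow> real"
    define y where "y = (\<Sum>j\<in>UNIV. (sqrt (k j / \<beta>) * \<xi> j) *\<^sub>R e j)"
    define Y where "Y = (\<Sum>j\<in>UNIV. k j / \<beta> * (\<xi> j)\<^sup>2)"
    define c where "c = real CARD('s) * log_quad (Y - 3/2)"
    have "y \<bullet> y = Y"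
      using k0 \<beta> unfolding Y_def
      by (subst parseval[OF e]) (simp add: y_def inner_orthonormal_sum[OF e] power2_eq_square mult_ac)
    have Y0: "Y \<ge> 0" unfolding Y_def using k0 \<beta> by (intro sum_nonneg mult_nonneg_nonneg divide_nonneg_pos) auto
    have col: "(\<Sum>j\<in>UNIV. sqrt (k j / \<beta>) * proj_col e \<Omega> j i * \<xi> j) = (\<Sum>m\<in>UNIV. \<Omega> $ m $ i * y $ m)"
      for \<Omega> :: "real^'s^'d" and i
      unfolding proj_col_def y_def sum_component sum_distrib_left sum_distrib_right
      by (subst sum.swap) (simp add: mult_ac)
    have "(\<integral>\<^sup>+\<Omega>. exp (smoothed_exponent e k \<beta> \<Omega> \<xi>) \<partial>(gaussian_matrix :: (real^'s^'d) measure))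
        = (\<integral>\<^sup>+\<Omega>. ennreal (exp c) * exp (- (2/3) * (\<Sum>i\<in>UNIV. (\<Sum>m\<in>UNIV. \<Omega> $ m $ i * y $ m)\<^sup>2)) \<partial>(gaussian_matrix :: (real^'s^'d) measure))"
      unfolding smoothed_exponent_def col Y_def[symmetric] c_def[symmetric]
      by (simp only: exp_add ennreal_mult' exp_ge_zero mult.commute)
    also have "\<dots> = ennreal (exp c) * ennreal ((1 / sqrt (1 + 2 * (2/3) * (y \<bullet> y))) ^ CARD('s))"
      by (subst nn_integral_cmult, measurable) (simp only: gaussian_matrix_exp_neg_square[of "2/3"])
    also have "\<dots> = ennreal (exp c * (1 / sqrt (1 + 4/3 * Y)) ^ CARD('s))"
      by (simp add: ennreal_mult' \<open>y \<bullet> y = Y\<close>)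
    also have "\<dots> \<le> 1"
      unfolding c_def using exp_log_quad_le[OF Y0] by simp
    finally show "(\<integral>\<^sup>+\<Omega>. exp (smoothed_exponent e k \<beta> \<Omega> \<xi>) \<partial>(gaussian_matrix :: (real^'s^'d) measure)) \<le> 1" .
  qed
  also have "\<dots> = 1" by (simp add: std_gaussian.emeasure_space_1[simplified])
  finally show ?thesis .
qed

text \<open>Translating by a kernel vector leaves the quadratic form in \<open>\<Omega>\<close>
  unchanged but raises the mean of the squared norm by 1. Since \<open>log_quad\<close> is
  quadratic, only the mean and variance of that norm are needed.\<close>

lemma partition_function_lower_bound:
  fixes \<Omega> :: "real^'s^'d" and x :: "'d \<Rightarrow> real"
  assumes ker: "\<And>i. (\<Sum>j\<in>UNIV. sqrt (k j) * x j * proj_col e \<Omega> j i) = 0"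
    and one: "(\<Sum>j\<in>UNIV. k j * (x j)\<^sup>2) = 1"
  defines "D \<equiv> \<Sum>j\<in>UNIV. k j"
  defines "w \<equiv> D / \<beta> - 1/2"
  shows "ennreal (exp (real CARD('s) * ((ln 3 + 4/9 * w - 16/81 * (w\<^sup>2 + (4 / \<beta> + 2 * D / \<beta>\<^sup>2))) / 2)
           - 2/3 * weighted_energy e k \<Omega> / \<beta> - \<beta> * (\<Sum>j\<in>UNIV. (x j)\<^sup>2) / 2)) \<le> partition_function e k \<beta> \<Omega>"
proof -
  define h where "h j = sqrt \<beta> * x j" for j
  define a where "a j = 2 * k j * x j / sqrt \<beta>" for j
  define b where "b j = k j / \<beta>" for j
  define S where "S \<xi> = (\<Sum>j\<in>UNIV. a j * \<xi> j + b j * ((\<xi> j)\<^sup>2 - 1))" for \<xi> :: "'d \<Rightarrow> real"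
  note S_moments = std_gaussian_centered_sum_square[of "\<lambda>j x. a j * x + b j * (x\<^sup>2 - 1)",
      OF std_normal_centered_quadratic(1-3), unfolded std_normal_centered_quadratic(4), folded S_def]
  define R where "R i \<xi> = (\<Sum>j\<in>UNIV. (sqrt (k j / \<beta>) * proj_col e \<Omega> j i) * \<xi> j)" for i \<xi>
  have Rshift: "R i (\<lambda>j. \<xi> j + h j) = R i \<xi>" for i \<xi>
  proof -
    have "R i (\<lambda>j. \<xi> j + h j) = R i \<xi> + (\<Sum>j\<in>UNIV. sqrt (k j) * x j * proj_col e \<Omega> j i)"
      unfolding R_def distrib_left sum.distrib
      using \<beta> by (simp add: h_def real_sqrt_divide mult_ac)
    then show ?thesis using ker by simp
  qed
  have Yshift: "(\<Sum>j\<in>UNIV. k j / \<beta> * (\<xi> j + h j)\<^sup>2) - 3/2 = w + S \<xi>" for \<xi>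
  proof -
    have "k j / \<beta> * (\<xi> j + h j)\<^sup>2 = k j * (x j)\<^sup>2 + k j / \<beta> + (a j * \<xi> j + b j * ((\<xi> j)\<^sup>2 - 1))" for j
    proof -
      define t where "t = sqrt \<beta>"
      have "\<beta> = t\<^sup>2" "t > 0" using \<beta> by (auto simp: t_def)
      then show ?thesis
        by (simp add: h_def a_def b_def power2_eq_square field_simps)
    qed
    then show ?thesis
      using one by (simp add: sum.distrib S_def w_def D_def sum_divide_distrib)
  qed
  let ?n = "real CARD('s)"
  \<comment> \<open>The shifted norm minus \<open>3/2\<close> is \<open>w + S \<xi>\<close> with
    \<open>S\<close> centered, so the linear term integrates to zero and the quadratic one to a
    variance.\<close>
  have F: "smoothed_exponent e k \<beta> \<Omega> (\<lambda>j. \<xi> j + h j) =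
      - (2/3) * (\<Sum>i\<in>UNIV. (R i \<xi>)\<^sup>2)
      + ?n * ((ln 3 + 4/9 * w - 16/81 * w\<^sup>2) / 2 + (4/9 - 32/81 * w) / 2 * S \<xi> - 8/81 * (S \<xi>)\<^sup>2)" for \<xi>
    unfolding smoothed_exponent_def Yshift R_def[symmetric] Rshift
    by (simp add: log_quad_def power2_eq_square field_simps)
  have Rint: "integrable std_gaussian (\<lambda>\<xi>. (R i \<xi>)\<^sup>2)" for i
    unfolding R_def by (rule std_gaussian_linear(1))
  have Rval: "(\<integral>\<xi>. (R i \<xi>)\<^sup>2 \<partial>std_gaussian) = (\<Sum>j\<in>UNIV. k j * (proj_col e \<Omega> j i)\<^sup>2) / \<beta>" for i
    unfolding R_def std_gaussian_linear(2)
    using k0 \<beta> by (simp add: power_mult_distrib sum_divide_distrib)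
  have int: "integrable std_gaussian (\<lambda>\<xi>. smoothed_exponent e k \<beta> \<Omega> (\<lambda>j. \<xi> j + h j))"
    unfolding F using Rint S_moments by simp
  have "(\<integral>\<xi>. smoothed_exponent e k \<beta> \<Omega> (\<lambda>j. \<xi> j + h j) \<partial>std_gaussian)
     = - (2/3) * (weighted_energy e k \<Omega> / \<beta>)
      + ?n * ((ln 3 + 4/9 * w - 16/81 * w\<^sup>2) / 2 - 8/81 * (\<Sum>j\<in>UNIV. (a j)\<^sup>2 + 2 * (b j)\<^sup>2))"
    unfolding F using Rint S_moments
    by (simp add: Rval std_gaussian.prob_space[simplified] weighted_energy_def sum_divide_distrib)
  moreover have "(\<Sum>j\<in>UNIV. (a j)\<^sup>2 + 2 * (b j)\<^sup>2) \<le> 4 / \<beta> + 2 * D / \<beta>\<^sup>2"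
  proof -
    have "(a j)\<^sup>2 + 2 * (b j)\<^sup>2 \<le> 4 / \<beta> * (k j * (x j)\<^sup>2) + 2 / \<beta>\<^sup>2 * k j" for j
    proof -
      have "(k j)\<^sup>2 \<le> k j" using k0[of j] k1[of j] by (simp add: power2_eq_square mult_left_le)
      then have "4 / \<beta> * ((k j)\<^sup>2 * (x j)\<^sup>2) + 2 / \<beta>\<^sup>2 * (k j)\<^sup>2 \<le> 4 / \<beta> * (k j * (x j)\<^sup>2) + 2 / \<beta>\<^sup>2 * k j"
        using \<beta> by (intro add_mono mult_left_mono mult_right_mono) auto
      moreover have "(a j)\<^sup>2 + 2 * (b j)\<^sup>2 = 4 / \<beta> * ((k j)\<^sup>2 * (x j)\<^sup>2) + 2 / \<beta>\<^sup>2 * (k j)\<^sup>2"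
        using \<beta> by (simp add: a_def b_def power_divide power_mult_distrib)
      ultimately show ?thesis by simp
    qed
    then have "(\<Sum>j\<in>UNIV. (a j)\<^sup>2 + 2 * (b j)\<^sup>2) \<le> (\<Sum>j\<in>UNIV. 4 / \<beta> * (k j * (x j)\<^sup>2) + 2 / \<beta>\<^sup>2 * k j)"
      by (rule sum_mono)
    also have "\<dots> = 4 / \<beta> + 2 * D / \<beta>\<^sup>2"
      unfolding sum.distrib sum_distrib_left[symmetric] one D_def by simp
    finally show ?thesis .
  qed
  then have "?n * (8/81 * (\<Sum>j\<in>UNIV. (a j)\<^sup>2 + 2 * (b j)\<^sup>2)) \<le> ?n * (8/81 * (4 / \<beta> + 2 * D / \<beta>\<^sup>2))"
    by (intro mult_left_mono) auto
  moreover have "(\<Sum>j\<in>UNIV. (h j)\<^sup>2) = \<beta> * (\<Sum>j\<in>UNIV. (x j)\<^sup>2)"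
    using \<beta> by (simp add: h_def power_mult_distrib sum_distrib_left)
  ultimately have "?n * ((ln 3 + 4/9 * w - 16/81 * (w\<^sup>2 + (4 / \<beta> + 2 * D / \<beta>\<^sup>2))) / 2)
           - 2/3 * weighted_energy e k \<Omega> / \<beta> - \<beta> * (\<Sum>j\<in>UNIV. (x j)\<^sup>2) / 2
      \<le> (\<integral>\<xi>. smoothed_exponent e k \<beta> \<Omega> (\<lambda>j. \<xi> j + h j) \<partial>std_gaussian) - (\<Sum>j\<in>UNIV. (h j)\<^sup>2) / 2"
    by (simp add: algebra_simps diff_divide_distrib add_divide_distrib)
  then have "ennreal (exp (?n * ((ln 3 + 4/9 * w - 16/81 * (w\<^sup>2 + (4 / \<beta> + 2 * D / \<beta>\<^sup>2))) / 2)
           - 2/3 * weighted_energy e k \<Omega> / \<beta> - \<beta> * (\<Sum>j\<in>UNIV. (x j)\<^sup>2) / 2))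
      \<le> ennreal (exp ((\<integral>\<xi>. smoothed_exponent e k \<beta> \<Omega> (\<lambda>j. \<xi> j + h j) \<partial>std_gaussian) - (\<Sum>j\<in>UNIV. (h j)\<^sup>2) / 2))"
    by (intro ennreal_leI) simp
  also have "\<dots> \<le> partition_function e k \<beta> \<Omega>"
    unfolding partition_function_def
    by (rule gaussian_smoothing_lower_bound[OF _ int]) measurable
  finally show ?thesis .
qed

end

subsection \<open>The good event and the theorem\<close>

text \<open>The good event excludes a large partition function (Markov) and a large column energy
  (Chernoff), each at a cost of at most \<open>\<delta> / 2\<close>. On it a violating vector would
  force the partition function above its threshold.\<close>

lemma gaussian_matrix_kernel_event:
  fixes e :: "'d \<Rightarrow> real^'d" and k :: "'d \<Rightarrow> real" and \<delta> :: real
  defines "D \<equiv> \<Sum>j\<in>UNIV. k j" and "L \<equiv> ln (16 / \<delta>)"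
  assumes e: "orthonormal_family e" and k0: "\<And>j. 0 \<le> k j" and k1: "\<And>j. k j \<le> 1"
    and \<delta>: "0 < \<delta>" "\<delta> < 1" and n: "8 * D + 64 * L \<le> real CARD('s)"
  shows "\<exists>A \<in> sets (gaussian_matrix :: (real^'s^'d) measure).
     measure gaussian_matrix A \<ge> 1 - \<delta> \<and>
     (\<forall>\<Omega>\<in>A. \<forall>x. (\<forall>i. (\<Sum>j\<in>UNIV. sqrt (k j) * x j * proj_col e \<Omega> j i) = 0) \<longrightarrow>
        (\<Sum>j\<in>UNIV. k j * (x j)\<^sup>2) \<le> 48/55 * (\<Sum>j\<in>UNIV. (x j)\<^sup>2))"
proof -
  let ?n = "real CARD('s)"
  let ?M = "gaussian_matrix :: (real^'s^'d) measure"
  define \<beta> where "\<beta> = ?n / 4"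
  have D0: "D \<ge> 0" unfolding D_def using k0 by (simp add: sum_nonneg)
  \<comment> \<open>As \<open>\<delta> < 1\<close>, \<open>L\<close> is at least
    \<open>ln 16 \<ge> 8/3\<close>, which makes \<open>64 * L\<close> exceed 170.\<close>
  have "ln 16 = 4 * ln (2::real)" using ln_realpow[of 2 4] by simp
  then have "8/3 \<le> ln (16::real)" using ln2_ge_two_thirds by simp
  also have "ln 16 \<le> L" unfolding L_def using \<delta> by (simp add: field_simps)
  finally have L: "8/3 \<le> L" .
  have n170: "?n \<ge> 170" using n L D0 by linarith
  have \<beta>0: "\<beta> > 0" using n170 by (simp add: \<beta>_def)
  define Z where "Z = (partition_function e k \<beta> :: real^'s^'d \<Rightarrow> ennreal)"
  define T where "T = (weighted_energy e k :: real^'s^'d \<Rightarrow> real)"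
  have [measurable]: "Z \<in> borel_measurable borel" "T \<in> borel_measurable borel"
    unfolding Z_def T_def by measurable
  \<comment> \<open>The mean energy is \<open>?n * D\<close>. With \<open>\<mu> = 2 / ?n\<close> the
    first-order terms cancel, and the excess contributes \<open>- ?n / 36\<close> to the Chernoff
    exponent.\<close>
  define \<tau> where "\<tau> = ?n * D + ?n\<^sup>2 / 72"
  define \<mu> where "\<mu> = 2 / ?n"
  define A1 where "A1 = {\<Omega>. ennreal (2 / \<delta>) \<le> Z \<Omega>}"
  define A2 where "A2 = {\<Omega>. \<tau> \<le> T \<Omega>}"
  have [measurable]: "A1 \<in> sets borel" "A2 \<in> sets borel"
    unfolding A1_def A2_def by measurable
  have "emeasure ?M A1 \<le> ennreal (\<delta> / 2)"
  proof -
    have "ennreal (2 / \<delta>) \<le> Z \<Omega> \<longleftrightarrow> 1 \<le> ennreal (\<delta> / 2) * Z \<Omega>" for \<Omega>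
    proof -
      have "ennreal (\<delta> / 2) * ennreal (2 / \<delta>) = 1" using \<delta> by (simp flip: ennreal_mult')
      then show ?thesis
        using \<delta> ennreal_mult_le_mult_iff[of "ennreal (\<delta> / 2)" "ennreal (2 / \<delta>)" "Z \<Omega>"] by simp
    qed
    then have "A1 = {\<Omega>\<in>space ?M. 1 \<le> ennreal (\<delta> / 2) * Z \<Omega>}" by (simp add: A1_def)
    then have "emeasure ?M A1 \<le> ennreal (\<delta> / 2) * (\<integral>\<^sup>+\<Omega>. Z \<Omega> * indicator (space ?M) \<Omega> \<partial>?M)"
      using nn_integral_Markov_inequality[of Z "space ?M" ?M "ennreal (\<delta> / 2)"] by simp
    also have "\<dots> \<le> ennreal (\<delta> / 2) * 1"
      using expectation_partition_function[where ?'s='s and k=k, OF e k0 k1 \<beta>0]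
      by (intro mult_left_mono) (auto simp: Z_def)
    finally show ?thesis by simp
  qed
  moreover have "emeasure ?M A2 \<le> ennreal (\<delta> / 2)"
  proof -
    have \<mu>: "0 \<le> \<mu>" "\<mu> \<le> 1/4" "\<mu> > 0" using n170 by (auto simp: \<mu>_def field_simps)
    have "A2 = {\<Omega>\<in>space ?M. 1 \<le> ennreal (exp (- \<mu> * \<tau>)) * ennreal (exp (\<mu> * T \<Omega>))}"
      using \<mu> by (auto simp: A2_def ennreal_mult'[symmetric] exp_add[symmetric])
    then have "emeasure ?M A2 \<le> ennreal (exp (- \<mu> * \<tau>)) * (\<integral>\<^sup>+\<Omega>. exp (\<mu> * T \<Omega>) * indicator (space ?M) \<Omega> \<partial>?M)"
      using nn_integral_Markov_inequality[of "\<lambda>\<Omega>. ennreal (exp (\<mu> * T \<Omega>))" "space ?M" ?M "ennreal (exp (- \<mu> * \<tau>))"] by simp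
    also have "\<dots> \<le> ennreal (exp (- \<mu> * \<tau>)) * ennreal (exp (?n * (\<mu> + 4 * \<mu>\<^sup>2) * D))"
      using gaussian_matrix_exp_weighted_square[where ?'s='s and k=k, OF e k0 k1 \<mu>(1,2)]
      by (intro mult_left_mono)
        (auto simp: T_def D_def weighted_energy_def proj_col_def)
    also have "\<dots> = ennreal (exp (16 * D / ?n - ?n / 36))"
    proof -
      have "- \<mu> * \<tau> + ?n * (\<mu> + 4 * \<mu>\<^sup>2) * D = 16 * D / ?n - ?n / 36"
        using n170 unfolding \<mu>_def \<tau>_def by (simp add: field_simps power2_eq_square)
      then show ?thesis by (simp add: ennreal_mult'[symmetric] exp_add[symmetric])
    qed
    also have "\<dots> \<le> ennreal (exp (- L))"
    proof -
      \<comment> \<open>The sketch size gives \<open>?n / 36 \<ge> 16/9 * L\<close>, and the surplus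
        \<open>7/9 * L\<close> exceeds 2 because \<open>L \<ge> 8/3\<close>.\<close>
      have "16 * D / ?n \<le> 2" using n L n170 by (simp add: field_simps)
      then have "16 * D / ?n - ?n / 36 \<le> - L" using n D0 L by linarith
      then show ?thesis by (intro ennreal_leI) simp
    qed
    also have "exp (- L) = \<delta> / 16" using \<delta> by (simp add: L_def exp_minus)
    also have "ennreal (\<delta> / 16) \<le> ennreal (\<delta> / 2)" using \<delta> by (intro ennreal_leI) simp
    finally show ?thesis .
  qed
  ultimately have "emeasure ?M (A1 \<union> A2) \<le> ennreal (\<delta> / 2) + ennreal (\<delta> / 2)"
    using emeasure_subadditive[of A1 ?M A2] by (auto intro: order_trans add_mono)
  then have bad: "measure ?M (A1 \<union> A2) \<le> \<delta>"
    using \<delta> by (simp add: gaussian_matrix.emeasure_eq_measure flip: ennreal_plus)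
  define A where "A = space ?M - (A1 \<union> A2)"
  have "measure ?M A \<ge> 1 - \<delta>"
    unfolding A_def using bad by (subst gaussian_matrix.prob_compl) auto
  moreover have "A \<in> sets ?M" unfolding A_def by measurable
  moreover have "(\<Sum>j\<in>UNIV. k j * (x j)\<^sup>2) \<le> 48/55 * (\<Sum>j\<in>UNIV. (x j)\<^sup>2)"
    if \<Omega>: "\<Omega> \<in> A" and ker: "\<And>i. (\<Sum>j\<in>UNIV. sqrt (k j) * x j * proj_col e \<Omega> j i) = 0" for \<Omega> x
  proof (rule ccontr)
    assume neg: "\<not> ?thesis"
    define p where "p = (\<Sum>j\<in>UNIV. k j * (x j)\<^sup>2)"
    have p: "p > 0"
      using neg sum_nonneg[of UNIV "\<lambda>j. (x j)\<^sup>2"] unfolding p_def[symmetric] by auto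
    \<comment> \<open>Homogeneity permits normalizing the weighted sum to 1; the violated inequality
      then bounds the plain sum by the reciprocal \<open>55/48\<close>.\<close>
    define x' where "x' j = x j / sqrt p" for j
    have sq: "(x' j)\<^sup>2 = (x j)\<^sup>2 / p" for j using p by (simp add: x'_def power_divide)
    have one: "(\<Sum>j\<in>UNIV. k j * (x' j)\<^sup>2) = 1"
      using p by (simp add: sq p_def sum_divide_distrib[symmetric])
    have X: "(\<Sum>j\<in>UNIV. (x' j)\<^sup>2) \<le> 55/48"
      using neg p by (simp add: sq p_def[symmetric] sum_divide_distrib[symmetric] field_simps)
    have ker': "(\<Sum>j\<in>UNIV. sqrt (k j) * x' j * proj_col e \<Omega> j i) = 0" for i
      using ker[of i] by (simp add: x'_def sum_divide_distrib[symmetric])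
    define w where "w = D / \<beta> - 1/2"
    define G where "G = ?n * ((ln 3 + 4/9 * w - 16/81 * (w\<^sup>2 + (4 / \<beta> + 2 * D / \<beta>\<^sup>2))) / 2)
           - 2/3 * T \<Omega> / \<beta> - \<beta> * (\<Sum>j\<in>UNIV. (x' j)\<^sup>2) / 2"
    have "ennreal (exp G) \<le> Z \<Omega>"
      unfolding G_def Z_def T_def w_def D_def
      by (rule partition_function_lower_bound[where k=k, OF e k0 k1 \<beta>0 ker' one])
    also have "Z \<Omega> < ennreal (2 / \<delta>)" using \<Omega> by (simp add: A_def A1_def not_le)
    finally have "exp G < 2 / \<delta>" using \<delta> by (simp add: ennreal_less_iff)
    also have "\<dots> \<le> exp L" using \<delta> by (simp add: L_def divide_right_mono)
    finally have "G < L" by simp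
    moreover have "L < ?n * ((ln 3 + 4/9 * w - 16/81 * (w\<^sup>2 + (4 / \<beta> + 2 * D / \<beta>\<^sup>2))) / 2)
        - 8/3 * T \<Omega> / ?n - ?n * (\<Sum>j\<in>UNIV. (x' j)\<^sup>2) / 8"
      using \<Omega> n n170 D0 L X
      by (intro smoothing_bound_exceeds_budget) (auto simp: \<beta>_def w_def A_def A2_def \<tau>_def power_divide)
    ultimately show False
      unfolding G_def \<beta>_def by simp
  qed
  ultimately show ?thesis by blast
qed

lemma nystrom_sketch_kernel_event:
  fixes H :: "real^'d^'d"
  assumes H: "psd_mat H" and \<rho>: "\<rho> > 0" and \<delta>: "0 < \<delta>" "\<delta> < 1"
    and n: "8 * eff_dim H \<rho> + 64 * ln (16 / \<delta>) \<le> real CARD('s)"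
  shows "\<exists>A \<in> sets (gaussian_matrix :: (real^'s^'d) measure).
     measure gaussian_matrix A \<ge> 1 - \<delta> \<and>
     (\<forall>\<Omega>\<in>A. \<forall>v. transpose \<Omega> *v (H *v v) = 0 \<longrightarrow>
        (H *v v) \<bullet> (H *v v) \<le> 48/55 * ((H *v v) \<bullet> (H *v v) + \<rho> * (v \<bullet> (H *v v))))"
proof -
  obtain e l where e: "orthonormal_family e" and l: "\<And>j. H *v e j = l j *\<^sub>R e j"
    using symmetric_eigenbasis[of H] H by (auto simp: psd_mat_def)
  note eff = eff_dim_spectral[OF H \<rho> e l]
  define k where "k j = l j / (l j + \<rho>)" for j
  have pos: "l j + \<rho> > 0" for j using eff(2)[of j] \<rho> by simp
  have k0: "0 \<le> k j" for j using eff(2)[of j] pos[of j] by (simp add: k_def)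
  have k1: "k j \<le> 1" for j using pos[of j] \<rho> by (simp add: k_def)
  have D: "eff_dim H \<rho> = (\<Sum>j\<in>UNIV. k j)" by (simp add: eff(1) k_def)
  obtain A :: "(real^'s^'d) set" where A: "A \<in> sets gaussian_matrix" "measure gaussian_matrix A \<ge> 1 - \<delta>"
    and good: "\<And>\<Omega> x. \<Omega> \<in> A \<Longrightarrow> (\<And>i. (\<Sum>j\<in>UNIV. sqrt (k j) * x j * proj_col e \<Omega> j i) = 0) \<Longrightarrow>
        (\<Sum>j\<in>UNIV. k j * (x j)\<^sup>2) \<le> 48/55 * (\<Sum>j\<in>UNIV. (x j)\<^sup>2)"
    using gaussian_matrix_kernel_event[where ?'s='s and k=k, OF e k0 k1 \<delta>] n unfolding D by blast
  have "(H *v v) \<bullet> (H *v v) \<le> 48/55 * ((H *v v) \<bullet> (H *v v) + \<rho> * (v \<bullet> (H *v v)))"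
    if \<Omega>: "\<Omega> \<in> A" and ker: "transpose \<Omega> *v (H *v v) = 0" for \<Omega> v
  proof -
    \<comment> \<open>Chosen so that \<open>sqrt (k j) * x j\<close> is the coordinate of
      \<open>H *v v\<close>. The product under the root avoids dividing by \<open>l j\<close>, which
      may be zero.\<close>
    define x where "x j = sqrt (l j * (l j + \<rho>)) * (v \<bullet> e j)" for j
    have Hv: "(H *v v) \<bullet> e j = l j * (v \<bullet> e j)" for j
      using H l by (simp add: psd_mat_def flip: sym_mat_inner)
    have kx: "sqrt (k j) * x j = l j * (v \<bullet> e j)" for j
    proof -
      have "sqrt (k j) * sqrt (l j * (l j + \<rho>)) = sqrt ((l j)\<^sup>2)"
        using pos[of j] by (subst real_sqrt_mult[symmetric]) (simp add: k_def power2_eq_square)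
      then show ?thesis using eff(2)[of j] by (simp add: x_def mult.assoc[symmetric])
    qed
    have "(\<Sum>j\<in>UNIV. sqrt (k j) * x j * proj_col e \<Omega> j i) = (transpose \<Omega> *v (H *v v)) $ i" for i
    proof -
      have "(transpose \<Omega> *v (H *v v)) $ i = column i \<Omega> \<bullet> (H *v v)"
        by (simp add: matrix_vector_mul_component transpose_def column_def)
      also have "\<dots> = (\<Sum>j\<in>UNIV. (column i \<Omega> \<bullet> e j) * ((H *v v) \<bullet> e j))"
        by (rule parseval[OF e])
      also have "\<dots> = (\<Sum>j\<in>UNIV. sqrt (k j) * x j * proj_col e \<Omega> j i)"
      proof -
        have "column i \<Omega> \<bullet> e j = proj_col e \<Omega> j i" for j
          by (simp add: proj_col_def inner_vec_def column_def)
        then show ?thesis by (simp add: kx Hv mult.commute[of "proj_col e \<Omega> _ i"])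
      qed
      finally show ?thesis by simp
    qed
    then have "(\<Sum>j\<in>UNIV. sqrt (k j) * x j * proj_col e \<Omega> j i) = 0" for i
      using ker by simp
    from good[OF \<Omega> this] have "(\<Sum>j\<in>UNIV. k j * (x j)\<^sup>2) \<le> 48/55 * (\<Sum>j\<in>UNIV. (x j)\<^sup>2)" .
    moreover have "(\<Sum>j\<in>UNIV. k j * (x j)\<^sup>2) = (H *v v) \<bullet> (H *v v)"
    proof -
      have "k j * (x j)\<^sup>2 = (sqrt (k j) * x j)\<^sup>2" for j using k0 by (simp add: power_mult_distrib)
      then show ?thesis
        using parseval[OF e, of "H *v v" "H *v v"] by (simp add: kx Hv power2_eq_square)
    qed
    moreover have "(\<Sum>j\<in>UNIV. (x j)\<^sup>2) = (H *v v) \<bullet> (H *v v) + \<rho> * (v \<bullet> (H *v v))"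
    proof -
      have "(x j)\<^sup>2 = (l j * (v \<bullet> e j))\<^sup>2 + \<rho> * ((v \<bullet> e j) * (l j * (v \<bullet> e j)))" for j
        using eff(2)[of j] pos[of j] by (simp add: x_def power_mult_distrib) (simp add: power2_eq_square algebra_simps)
      then show ?thesis
        using parseval[OF e, of "H *v v" "H *v v"] parseval[OF e, of v "H *v v"]
        by (simp add: Hv sum.distrib power2_eq_square sum_distrib_left)
    qed
    ultimately show ?thesis by simp
  qed
  then show ?thesis using A by blast
qed

text \<open>Eigendecompositions are not unique, so one event serves all of them. An explicit
  measurable event inside the set of good sketches carries the probability bound.\<close>

theorem theorem4p1:
  fixes H :: "real^'d^'d" and \<rho> \<delta> :: real
  assumes "psd_mat H"
    and "\<rho> > 0"
    and "0 < \<delta>" and "\<delta> < 1"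
    and "real CARD('s) \<ge> 8 * (sqrt (eff_dim H \<rho>) + sqrt (8 * ln (16 / \<delta>)))\<^sup>2"
  shows "\<exists>A \<in> sets (gaussian_matrix :: (real^'s^'d) measure).
           measure gaussian_matrix A \<ge> 1 - \<delta> \<and>
           (\<forall>\<Omega> \<in> A. \<forall>U \<Lambda>. nystrom_eig H \<Omega> U \<Lambda> \<longrightarrow>
              cond2 (mat_inv_sqrt (nystrom_precond \<rho> U \<Lambda>) ** (H + \<rho> *\<^sub>R mat 1)
                     ** mat_inv_sqrt (nystrom_precond \<rho> U \<Lambda>)) \<le> 8)"
proof -
  note H = assms(1) and \<rho> = assms(2)
  define D where "D = eff_dim H \<rho>"
  define L where "L = ln (16 / \<delta>)"
  obtain e l where e: "orthonormal_family e" and l: "\<And>j. H *v e j = l j *\<^sub>R e j"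
    using symmetric_eigenbasis[of H] H by (auto simp: psd_mat_def)
  have D0: "D \<ge> 0"
    unfolding D_def eff_dim_spectral(1)[OF H \<rho> e l] using eff_dim_spectral(2)[OF H \<rho> e l] \<rho>
    by (intro sum_nonneg divide_nonneg_nonneg add_nonneg_nonneg) auto
  have L0: "L \<ge> 0" unfolding L_def using assms(3,4) by simp
  \<comment> \<open>The square is expanded and its nonnegative cross term dropped.\<close>
  have "D + 8 * L \<le> (sqrt D + sqrt (8 * L))\<^sup>2"
    using D0 L0 by (simp add: power2_sum)
  then have n: "8 * D + 64 * L \<le> real CARD('s)"
    using assms(5) unfolding D_def[symmetric] L_def[symmetric] by linarith
  obtain A :: "(real^'s^'d) set" where A: "A \<in> sets gaussian_matrix" "measure gaussian_matrix A \<ge> 1 - \<delta>"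
    and ker: "\<And>\<Omega> v. \<Omega> \<in> A \<Longrightarrow> transpose \<Omega> *v (H *v v) = 0 \<Longrightarrow>
        (H *v v) \<bullet> (H *v v) \<le> 48/55 * ((H *v v) \<bullet> (H *v v) + \<rho> * (v \<bullet> (H *v v)))"
    using nystrom_sketch_kernel_event[OF H \<rho> assms(3,4), where ?'s='s] n unfolding D_def L_def by blast
  have "cond2 (mat_inv_sqrt (nystrom_precond \<rho> U \<Lambda>) ** (H + \<rho> *\<^sub>R mat 1)
          ** mat_inv_sqrt (nystrom_precond \<rho> U \<Lambda>)) \<le> 8"
    if \<Omega>: "\<Omega> \<in> A" and eig: "nystrom_eig H \<Omega> U \<Lambda>" for \<Omega> U \<Lambda>
  proof -
    define m where "m = diag_min \<Lambda>"
    have U: "transpose U ** U = mat 1" and diag: "\<And>i j. i \<noteq> j \<Longrightarrow> \<Lambda> $ i $ j = 0"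
      and nonneg: "\<And>i. 0 \<le> \<Lambda> $ i $ i" and ny: "nystrom H \<Omega> = U ** \<Lambda> ** transpose U"
      using eig by (auto simp: nystrom_eig_def)
    have m0: "m \<ge> 0" unfolding m_def using nonneg by (rule diag_min_nonneg)
    have "m * ((transpose U *v x) \<bullet> (transpose U *v x)) \<le> x \<bullet> (H *v x)" for x
    proof -
      have "m * ((transpose U *v x) \<bullet> (transpose U *v x)) \<le> (transpose U *v x) \<bullet> (\<Lambda> *v (transpose U *v x))"
        unfolding m_def by (rule diag_min_quadratic_form_le[OF diag])
      also have "\<dots> = x \<bullet> (nystrom H \<Omega> *v x)"
        by (simp add: ny inner_mult_transpose_eq[of x U] flip: matrix_vector_mul_assoc)
      also have "\<dots> \<le> x \<bullet> (H *v x)" by (rule nystrom_le[OF H])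
      finally show ?thesis .
    qed
    \<comment> \<open>Combined with \<open>8 * D \<le> real CARD('s)\<close> this forces
      \<open>m / (m + \<rho>) \<le> 1 / 8\<close>, that is
      \<open>m \<le> 1/7 * \<rho>\<close>.\<close>
    then have "real CARD('s) * (m / (m + \<rho>)) \<le> D"
      unfolding D_def by (rule eff_dim_lower_bound[OF H \<rho> m0 U])
    then have "real CARD('s) * (m / (m + \<rho>)) \<le> real CARD('s) * (1 / 8)"
      by (rule order_trans) (use n L0 in simp)
    then have "m / (m + \<rho>) \<le> 1 / 8"
      by (rule mult_left_le_imp_le) simp
    then have "m \<le> 1/7 * \<rho>" using m0 \<rho> by (simp add: field_simps)
    \<comment> \<open>The kernel constant \<open>\<eta> = 48/55\<close> has
      \<open>\<eta> / (1 - \<eta>) = 48/7\<close>, which is what remains of 8 after 1 and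
      1/7.\<close>
    moreover have "x \<bullet> (H *v x) - x \<bullet> (nystrom H \<Omega> *v x) \<le> 48/7 * \<rho> * (x \<bullet> x)" for x
      using nystrom_error_bound[where x=x, OF H _ _ _ ker[OF \<Omega>]] \<rho> by simp
    ultimately have "cond2 (mat_inv_sqrt (nystrom_precond \<rho> U \<Lambda>) ** (H + \<rho> *\<^sub>R mat 1)
          ** mat_inv_sqrt (nystrom_precond \<rho> U \<Lambda>)) \<le> 1 + 1/7 + 48/7"
      unfolding m_def by (intro nystrom_precond_cond2[OF H \<rho> eig]) auto
    then show ?thesis by simp
  qed
  then show ?thesis using A by blast
qed

end
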